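(* The emptiness problem for register set automata with register equality test is undecidable.
   Context: Fix a finite nonempty alphabet $\Sigma$ and an infinite data domain $\mathbb{D}$. A register set automaton with register equality test is a tuple $(Q,R,\Delta,I,F)$ with $Q$ finite states, $R$ finite registers, $I,F\subseteq Q$, and transitions $q\xrightarrow{a\mid G^{\in},G^{\notin},G^{=},up}s$ with $a\in\Sigma$, $G^{\in},G^{\notin}\subseteq R$, $G^{=}\colon R\to 2^{R}$, and $up\colon R\to 2^{R\cup\{\mathit{in}\}}$. Configurations are $(q,f)$ with $f\colon R\to 2^{\mathbb{D}}$; initial ones have $q\in I$ and all registers empty. A step over $(a,d)\in\Sigma\times\mathbb{D}$ is possible iff $d\in f(r)$ for all $r\in G^{\in}$, $d\notin f(r)$ for all $r\in G^{\notin}$, and $f(r')=f(r)$ for all $r\in R$ and $r'\in G^{=}(r)$; afterwards each register $r$ holds $\bigcup\{f(r')\mid r'\in R\cap up(r)\}$, plus $d$ if $\mathit{in}\in up(r)$. The language is the set of words in $(\Sigma\times\mathbb{D})^*$ with a run from an initial configuration ending in $F$; the emptiness problem asks whether this language is empty. *)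

theory Defs
  imports "HOL-Library.FuncSet" "HOL-Library.Nat_Bijection"
begin

section \<open>Register set automata with register equality test\<close>

datatype 'r source = In | Reg 'r

record ('q, 'a, 'r) transition =
  src :: 'q
  letter :: 'a
  gin :: "'r set"
  gnotin :: "'r set"
  geq :: "'r \<Rightarrow> 'r set"
  upd :: "'r \<Rightarrow> 'r source set"
  tgt :: 'q

record ('q, 'a, 'r) rsa =
  States :: "'q set"
  Regs :: "'r set"
  Trans :: "('q, 'a, 'r) transition set"
  Init :: "'q set"
  Final :: "'q set"

text \<open>Functions with domain \<open>R\<close> are represented extensionally (\<open>\<rightarrow>\<^sub>E\<close>), so that
  equality of transitions and of configurations is equality of functions on \<open>R\<close>.\<close>

definition is_transition ::
  "'a set \<Rightarrow> 'q set \<Rightarrow> 'r set \<Rightarrow> ('q, 'a, 'r) transition \<Rightarrow> bool" where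
  "is_transition \<Sigma> Q R t \<longleftrightarrow>
     src t \<in> Q \<and> letter t \<in> \<Sigma> \<and> gin t \<subseteq> R \<and> gnotin t \<subseteq> R \<and>
     geq t \<in> R \<rightarrow>\<^sub>E Pow R \<and> upd t \<in> R \<rightarrow>\<^sub>E Pow (insert In (Reg ` R)) \<and> tgt t \<in> Q"

text \<open>Over a finite alphabet the transition relation is then automatically finite, see
  \<open>finite_Trans\<close> below.\<close>

definition is_rsa :: "'a set \<Rightarrow> ('q, 'a, 'r) rsa \<Rightarrow> bool" where
  "is_rsa \<Sigma> A \<longleftrightarrow>
     finite (States A) \<and> finite (Regs A) \<and>
     (\<forall>t\<in>Trans A. is_transition \<Sigma> (States A) (Regs A) t) \<and>
     Init A \<subseteq> States A \<and> Final A \<subseteq> States A"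

type_synonym ('q, 'r, 'd) config = "'q \<times> ('r \<Rightarrow> 'd set)"

definition initial_config :: "('q, 'a, 'r) rsa \<Rightarrow> ('q, 'r, 'd) config \<Rightarrow> bool" where
  "initial_config A cf \<longleftrightarrow> fst cf \<in> Init A \<and> snd cf = (\<lambda>r\<in>Regs A. {})"

definition enabled ::
  "'r set \<Rightarrow> ('q, 'a, 'r) transition \<Rightarrow> ('r \<Rightarrow> 'd set) \<Rightarrow> 'd \<Rightarrow> bool" where
  "enabled R t f d \<longleftrightarrow>
     (\<forall>r\<in>gin t. d \<in> f r) \<and> (\<forall>r\<in>gnotin t. d \<notin> f r) \<and>
     (\<forall>r\<in>R. \<forall>r'\<in>geq t r. f r' = f r)"

definition update ::
  "'r set \<Rightarrow> ('q, 'a, 'r) transition \<Rightarrow> ('r \<Rightarrow> 'd set) \<Rightarrow> 'd \<Rightarrow> ('r \<Rightarrow> 'd set)" where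
  "update R t f d = (\<lambda>r\<in>R.
     (\<Union>r'\<in>{r'\<in>R. Reg r' \<in> upd t r}. f r') \<union> (if In \<in> upd t r then {d} else {}))"

definition step ::
  "('q, 'a, 'r) rsa \<Rightarrow> ('q, 'r, 'd) config \<Rightarrow> 'a \<times> 'd \<Rightarrow> ('q, 'r, 'd) config \<Rightarrow> bool" where
  "step A cf x cf' \<longleftrightarrow>
     (\<exists>t\<in>Trans A. src t = fst cf \<and> letter t = fst x \<and>
        enabled (Regs A) t (snd cf) (snd x) \<and>
        cf' = (tgt t, update (Regs A) t (snd cf) (snd x)))"

inductive run ::
  "('q, 'a, 'r) rsa \<Rightarrow> ('q, 'r, 'd) config \<Rightarrow> ('a \<times> 'd) list \<Rightarrow> ('q, 'r, 'd) config \<Rightarrow> bool"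
  for A where
  run_Nil: "run A cf [] cf"
| run_Cons: "step A cf x cf' \<Longrightarrow> run A cf' w cf'' \<Longrightarrow> run A cf (x # w) cf''"

definition rsa_language ::
  "'a set \<Rightarrow> 'd set \<Rightarrow> ('q, 'a, 'r) rsa \<Rightarrow> ('a \<times> 'd) list set" where
  "rsa_language \<Sigma> \<DD> A =
     {w \<in> lists (\<Sigma> \<times> \<DD>). \<exists>cf cf'. initial_config A cf \<and> run A cf w cf' \<and> fst cf' \<in> Final A}"

section \<open>Decidability\<close>

text \<open>Programs for the \<open>\<mu>\<close>-recursive functions. Arities are left implicit: an application to an
  unsuitable number of arguments has no value. For every fixed number of arguments the
  functions computed are exactly the partial recursive ones.\<close>

datatype recf = Zero | Succ | Proj nat | Comp recf "recf list" | PrimRec recf recf | Mu recf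

inductive eval :: "recf \<Rightarrow> nat list \<Rightarrow> nat \<Rightarrow> bool" where
  eval_Zero: "eval Zero xs 0"
| eval_Succ: "eval Succ [x] (Suc x)"
| eval_Proj: "i < length xs \<Longrightarrow> eval (Proj i) xs (xs ! i)"
| eval_Comp: "list_all2 (\<lambda>g y. eval g xs y) gs ys \<Longrightarrow> eval f ys z \<Longrightarrow> eval (Comp f gs) xs z"
| eval_PrimRec_0: "eval f xs y \<Longrightarrow> eval (PrimRec f g) (0 # xs) y"
| eval_PrimRec_Suc:
    "eval (PrimRec f g) (n # xs) y \<Longrightarrow> eval g (n # y # xs) z \<Longrightarrow>
     eval (PrimRec f g) (Suc n # xs) z"
| eval_Mu: "eval f (n # xs) 0 \<Longrightarrow> (\<forall>m<n. \<exists>y>0. eval f (m # xs) y) \<Longrightarrow> eval (Mu f) xs n"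

inductive_cases eval_ZeroE: "eval Zero xs z"
inductive_cases eval_SuccE: "eval Succ xs z"
inductive_cases eval_ProjE: "eval (Proj i) xs z"
inductive_cases eval_CompE: "eval (Comp f gs) xs z"
inductive_cases eval_PrimRec_0E: "eval (PrimRec f g) (0 # xs) z"
inductive_cases eval_PrimRec_SucE: "eval (PrimRec f g) (Suc n # xs) z"
inductive_cases eval_MuE: "eval (Mu f) xs z"

lemma eval_deterministic: "eval p xs y \<Longrightarrow> eval p xs z \<Longrightarrow> y = z"
proof (induction arbitrary: z rule: eval.induct)
  case (eval_Zero xs)
  then show ?case by (rule eval_ZeroE) simp
next
  case (eval_Succ x)
  then show ?case by (rule eval_SuccE) simp
next
  case (eval_Proj i xs)
  from eval_Proj.prems show ?case by (rule eval_ProjE) simp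
next
  case (eval_Comp xs gs ys f z z')
  from eval_Comp.prems obtain ys' where
    ys': "list_all2 (\<lambda>g y. eval g xs y) gs ys'" "eval f ys' z'"
    by (rule eval_CompE)
  have "ys = ys'"
    using eval_Comp.IH(1) ys'(1) by (auto simp: list_all2_conv_all_nth intro!: nth_equalityI)
  with ys'(2) eval_Comp.IH(2) show ?case by blast
next
  case (eval_PrimRec_0 f xs y g)
  from eval_PrimRec_0.prems show ?case by (rule eval_PrimRec_0E) (rule eval_PrimRec_0.IH)
next
  case (eval_PrimRec_Suc f g n xs y z z')
  from eval_PrimRec_Suc.prems obtain y' where
    "eval (PrimRec f g) (n # xs) y'" "eval g (n # y' # xs) z'"
    by (rule eval_PrimRec_SucE)
  with eval_PrimRec_Suc.IH show ?case by blast
next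
  case (eval_Mu f n xs k)
  from eval_Mu.prems have k: "eval f (k # xs) 0" "\<forall>m<k. \<exists>y>0. eval f (m # xs) y"
    by (blast elim: eval_MuE)+
  have "\<not> n < k" using k(2) eval_Mu.IH(1) by (metis less_irrefl)
  moreover have "\<not> k < n" using k(1) eval_Mu.IH(2) by (metis less_irrefl)
  ultimately show ?case by simp
qed

text \<open>The problem with instances \<open>X\<close>, coded as numbers by \<open>code\<close>, and yes-instances
  \<open>{x \<in> X. P x}\<close>. The deciding program has to halt and to be correct on the codes of instances
  only, so undecidability cannot come from the difficulty of recognising codes.\<close>

definition decidable :: "('x \<Rightarrow> nat) \<Rightarrow> 'x set \<Rightarrow> ('x \<Rightarrow> bool) \<Rightarrow> bool" where
  "decidable code X P \<longleftrightarrow> (\<exists>p. \<forall>x\<in>X. eval p [code x] (if P x then 1 else 0))"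

section \<open>Coding automata as numbers\<close>

text \<open>States and registers are natural numbers, and the parameter \<open>c\<close> numbers the letters. Finite
  sets of numbers are coded by their bit vectors (\<open>set_encode\<close>), functions on \<open>R\<close> with set
  values by the set of pairs \<open>(r, x)\<close> with \<open>x \<in> g r\<close>. On the automata over \<open>\<Sigma>\<close> this is injective
  (\<open>inj_on_rsa_code\<close> below).\<close>

fun source_code :: "nat source \<Rightarrow> nat" where
  "source_code In = 0"
| "source_code (Reg r) = Suc r"

definition fun_code :: "nat set \<Rightarrow> ('x \<Rightarrow> nat) \<Rightarrow> (nat \<Rightarrow> 'x set) \<Rightarrow> nat" where
  "fun_code R k g = set_encode {prod_encode (r, k x) | r x. r \<in> R \<and> x \<in> g r}"

definition transition_code :: "('a \<Rightarrow> nat) \<Rightarrow> nat set \<Rightarrow> (nat, 'a, nat) transition \<Rightarrow> nat" where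
  "transition_code c R t = list_encode
     [src t, c (letter t), set_encode (gin t), set_encode (gnotin t),
      fun_code R id (geq t), fun_code R source_code (upd t), tgt t]"

definition rsa_code :: "('a \<Rightarrow> nat) \<Rightarrow> (nat, 'a, nat) rsa \<Rightarrow> nat" where
  "rsa_code c A = list_encode
     [set_encode (States A), set_encode (Regs A),
      set_encode (transition_code c (Regs A) ` Trans A),
      set_encode (Init A), set_encode (Final A)]"

lemma finite_Trans:
  fixes A :: "('q, 'a, 'r) rsa"
  assumes "finite \<Sigma>" and "is_rsa \<Sigma> A"
  shows "finite (Trans A)"
proof -
  let ?Q = "States A" and ?R = "Regs A"
  let ?h = "\<lambda>t :: ('q, 'a, 'r) transition.
    (src t, letter t, gin t, gnotin t, geq t, upd t, tgt t)"
  let ?X = "?Q \<times> \<Sigma> \<times> Pow ?R \<times> Pow ?R \<times> (?R \<rightarrow>\<^sub>E Pow ?R) \<times>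
    (?R \<rightarrow>\<^sub>E Pow (insert In (Reg ` ?R))) \<times> ?Q"
  have "finite ?X"
    using assms by (intro finite_cartesian_product finite_PiE) (simp_all add: is_rsa_def)
  moreover have "?h ` Trans A \<subseteq> ?X"
    using assms(2) unfolding is_rsa_def is_transition_def by blast
  ultimately have "finite (?h ` Trans A)" by (rule finite_subset[rotated])
  moreover have "inj_on ?h (Trans A)" by (rule inj_onI) (simp add: transition.equality)
  ultimately show ?thesis by (rule finite_imageD)
qed

lemma fun_code_inject:
  assumes "finite R" and "finite B" and "inj_on k B"
    and "g \<in> R \<rightarrow>\<^sub>E Pow B" and "h \<in> R \<rightarrow>\<^sub>E Pow B" and eq: "fun_code R k g = fun_code R k h"
  shows "g = h"
proof -
  let ?S = "\<lambda>g. {prod_encode (r, k x) | r x. r \<in> R \<and> x \<in> g r}"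
  have fin: "finite (?S f)" if "f \<in> R \<rightarrow>\<^sub>E Pow B" for f
  proof (rule finite_subset)
    show "?S f \<subseteq> (\<lambda>(r, x). prod_encode (r, k x)) ` (R \<times> B)" using PiE_mem[OF that] by fastforce
    show "finite ((\<lambda>(r, x). prod_encode (r, k x)) ` (R \<times> B))" using assms(1,2) by simp
  qed
  have S: "?S g = ?S h"
    using eq set_encode_eq[OF fin[OF assms(4)] fin[OF assms(5)]] by (simp add: fun_code_def)
  have mem: "x \<in> f r \<longleftrightarrow> prod_encode (r, k x) \<in> ?S f"
    if "f \<in> R \<rightarrow>\<^sub>E Pow B" "r \<in> R" "x \<in> B" for f r x
  proof
    assume "prod_encode (r, k x) \<in> ?S f"
    then obtain y where y: "k y = k x" "y \<in> f r" by (auto simp: prod_encode_eq)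
    from y(2) PiE_mem[OF that(1,2)] have "y \<in> B" by blast
    with y that assms(3) show "x \<in> f r" by (metis inj_onD)
  qed (use that(2) in blast)
  show ?thesis
  proof (rule PiE_ext[OF assms(4,5)])
    fix r assume r: "r \<in> R"
    have "g r \<subseteq> B" "h r \<subseteq> B" using PiE_mem[OF assms(4) r] PiE_mem[OF assms(5) r] by simp_all
    moreover have "x \<in> g r \<longleftrightarrow> x \<in> h r" if "x \<in> B" for x
      unfolding mem[OF assms(4) r that] mem[OF assms(5) r that] S ..
    ultimately show "g r = h r" by blast
  qed
qed

lemma inj_on_transition_code:
  assumes "inj_on c \<Sigma>" and "finite R"
  shows "inj_on (transition_code c R) {t. is_transition \<Sigma> Q R t}"
proof (rule inj_onI; clarsimp)
  fix t u :: "(nat, 'a, nat) transition"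
  assume t: "is_transition \<Sigma> Q R t" and u: "is_transition \<Sigma> Q R u"
    and eq: "transition_code c R t = transition_code c R u"
  have k: "inj_on source_code (insert In (Reg ` R))"
    by (auto simp: inj_on_def)
  have codes: "src t = src u" "c (letter t) = c (letter u)" "tgt t = tgt u"
    "set_encode (gin t) = set_encode (gin u)" "set_encode (gnotin t) = set_encode (gnotin u)"
    "fun_code R id (geq t) = fun_code R id (geq u)"
    "fun_code R source_code (upd t) = fun_code R source_code (upd u)"
    using eq by (simp_all add: transition_code_def list_encode_eq del: list_encode.simps)
  have "letter t = letter u"
    using codes t u assms(1) by (auto simp: is_transition_def dest: inj_onD)
  moreover have "gin t = gin u" "gnotin t = gnotin u"
    using codes t u assms(2) set_encode_eq finite_subset unfolding is_transition_def by metis+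
  moreover have "geq t = geq u"
    using t u codes assms(2)
    by (intro fun_code_inject[where B = R and R = R and k = id]) (auto simp: is_transition_def)
  moreover have "upd t = upd u"
    using t u codes assms(2) k
    by (intro fun_code_inject[where B = "insert In (Reg ` R)" and R = R and k = source_code])
      (auto simp: is_transition_def)
  ultimately show "t = u" using codes by (simp add: transition.equality)
qed

lemma inj_on_rsa_code:
  assumes "finite \<Sigma>" and "inj_on c \<Sigma>"
  shows "inj_on (rsa_code c) {A. is_rsa \<Sigma> A}"
proof (rule inj_onI; clarsimp)
  fix A B :: "(nat, 'a, nat) rsa"
  assume A: "is_rsa \<Sigma> A" and B: "is_rsa \<Sigma> B" and eq: "rsa_code c A = rsa_code c B"
  have codes: "set_encode (States A) = set_encode (States B)"
    "set_encode (Regs A) = set_encode (Regs B)"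
    "set_encode (transition_code c (Regs A) ` Trans A) =
      set_encode (transition_code c (Regs B) ` Trans B)"
    "set_encode (Init A) = set_encode (Init B)" "set_encode (Final A) = set_encode (Final B)"
    using eq by (simp_all add: rsa_code_def list_encode_eq del: list_encode.simps)
  have fin: "finite (Trans A)" "finite (Trans B)"
    using A B assms(1) by (auto intro: finite_Trans)
  have QR: "States A = States B" "Regs A = Regs B"
    using codes A B set_encode_eq unfolding is_rsa_def by blast+
  have "Init A = Init B" "Final A = Final B"
    using codes A B set_encode_eq finite_subset unfolding is_rsa_def by metis+
  moreover have "transition_code c (Regs A) ` Trans A = transition_code c (Regs A) ` Trans B"
    using codes(3) fin QR set_encode_eq by (metis finite_imageI)
  then have "Trans A = Trans B"
    using inj_on_image_eq_iff[OF inj_on_transition_code[OF assms(2)], of "Regs A" "Trans A" "States A"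
      "Trans B"] A B QR by (auto simp: is_rsa_def subset_iff)
  ultimately show "A = B" using QR by (simp add: rsa.equality)
qed

end

theory Submission
  imports Defs
begin

text \<open>A counter is represented by two registers \<open>V \<subseteq> U\<close> with value \<open>|U - V|\<close>: it is incremented by
  adding a fresh datum to \<open>U\<close>, decremented by adding a datum of \<open>U - V\<close> to \<open>V\<close>, and tested for zero
  by \<open>U = V\<close>. So register set automata simulate counter programs, to which \<open>\<mu>\<close>-recursive functions
  are compiled.

  Suppose \<open>p\<close> decides emptiness. Consider automata that first load a number \<open>x\<close> into a counter by
  \<open>x\<close> transitions and then run a fixed control part. If \<open>x\<close> is itself the code of the transitions of
  the control part, then the code of the whole automaton is a primitive recursive function of \<open>x\<close>,
  because bit vectors of disjoint sets are added. Hence the control part can compute the answer of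
  \<open>p\<close> on its own automaton, and accept iff that answer is \<open>empty\<close>.\<close>

section \<open>A counter language\<close>

datatype com = Inc nat | Loop nat "com list"

text \<open>\<open>Loop r b\<close> is \<open>while r > 0 do (r := r - 1; b)\<close>.\<close>

inductive halts :: "com list \<Rightarrow> (nat \<Rightarrow> nat) \<Rightarrow> bool" where
  halts_Nil: "halts [] s"
| halts_Inc: "halts ks (s(r := Suc (s r))) \<Longrightarrow> halts (Inc r # ks) s"
| halts_Loop_0: "s r = 0 \<Longrightarrow> halts ks s \<Longrightarrow> halts (Loop r b # ks) s"
| halts_Loop_Suc: "s r = Suc n \<Longrightarrow> halts (b @ Loop r b # ks) (s(r := n)) \<Longrightarrow> halts (Loop r b # ks) s"

inductive_cases halts_IncE: "halts (Inc r # ks) s"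
inductive_cases halts_LoopE: "halts (Loop r b # ks) s"

lemma halts_Inc_iff: "halts (Inc r # ks) s \<longleftrightarrow> halts ks (s(r := Suc (s r)))"
  by (auto intro: halts_Inc elim: halts_IncE)

lemma halts_Loop_0_iff: "s r = 0 \<Longrightarrow> halts (Loop r b # ks) s \<longleftrightarrow> halts ks s"
  by (auto intro: halts_Loop_0 elim: halts_LoopE)

lemma halts_Loop_Suc_iff:
  "s r = Suc n \<Longrightarrow> halts (Loop r b # ks) s \<longleftrightarrow> halts (b @ Loop r b # ks) (s(r := n))"
  by (auto intro: halts_Loop_Suc elim: halts_LoopE)

text \<open>The decrement at loop entry and the increment in the body cancel. This loop turns a
  nonzero result into divergence.\<close>

lemma not_halts_Loop_Inc:
  assumes "s r > 0"
  shows "\<not> halts [Loop r [Inc r]] s"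
proof
  \<comment> \<open>Both configurations of the cycle are covered, since one derivation step leads
    from each to the other.\<close>
  have "\<not> (ks = [Loop r [Inc r]] \<and> s r > 0 \<or> ks = [Inc r, Loop r [Inc r]])" if "halts ks s" for ks s
    using that by induction auto
  moreover assume "halts [Loop r [Inc r]] s"
  ultimately show False using assms by blast
qed

text \<open>As computations are deterministic, running \<open>cs\<close> from \<open>s\<close> ends in \<open>s'\<close> if skipping \<open>cs\<close> and
  continuing from \<open>s'\<close> never affects termination.\<close>

definition leads :: "com list \<Rightarrow> (nat \<Rightarrow> nat) \<Rightarrow> (nat \<Rightarrow> nat) \<Rightarrow> bool" where
  "leads cs s s' \<longleftrightarrow> (\<forall>ks. halts (cs @ ks) s \<longleftrightarrow> halts ks s')"

lemma leads_Nil: "leads [] s s"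
  by (simp add: leads_def)

lemma leads_NilI: "s = s' \<Longrightarrow> leads [] s s'"
  by (simp add: leads_Nil)

lemma leads_append: "leads cs s s' \<Longrightarrow> leads ds s' s'' \<Longrightarrow> leads (cs @ ds) s s''"
  by (simp add: leads_def)

lemma leads_Inc: "leads cs (s(r := Suc (s r))) s' \<Longrightarrow> leads (Inc r # cs) s s'"
  by (simp add: leads_def halts_Inc_iff)

lemma leads_Loop_0: "s r = 0 \<Longrightarrow> leads cs s s' \<Longrightarrow> leads (Loop r b # cs) s s'"
  by (simp add: leads_def halts_Loop_0_iff)

lemma leads_Loop_Suc:
  "s r = Suc n \<Longrightarrow> leads b (s(r := n)) s' \<Longrightarrow> leads (Loop r b # cs) s' s'' \<Longrightarrow>
   leads (Loop r b # cs) s s''"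
  by (simp add: leads_def halts_Loop_Suc_iff)

lemma leads_Cons: "leads [c] s s' \<Longrightarrow> leads cs s' s'' \<Longrightarrow> leads (c # cs) s s''"
  using leads_append[of "[c]"] by simp

abbreviation clear :: "nat \<Rightarrow> com" where
  "clear r \<equiv> Loop r []"

lemma leads_clear: "leads [clear r] s (s(r := 0))"
proof (induction "s r" arbitrary: s)
  case 0
  then have "s(r := 0) = s" by auto
  with 0 show ?case by (auto intro: leads_Loop_0 leads_Nil)
next
  case (Suc n)
  from Suc(1)[of "s(r := n)"] Suc(2)[symmetric] show ?case
    by (auto intro: leads_Loop_Suc[where s' = "s(r := n)"] leads_Nil)
qed

lemma leads_clear_list: "leads (map clear rs) s (\<lambda>r. if r \<in> set rs then 0 else s r)"
proof (induction rs arbitrary: s)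
  case Nil
  then show ?case by (simp add: leads_Nil)
next
  case (Cons r rs)
  have "leads (map clear (r # rs)) s (\<lambda>i. if i \<in> set rs then 0 else (s(r := 0)) i)"
    unfolding list.map by (rule leads_Cons[OF leads_clear Cons])
  moreover have "(\<lambda>i. if i \<in> set rs then 0 else (s(r := 0)) i) = (\<lambda>i. if i \<in> set (r # rs) then 0 else s i)"
    by auto
  ultimately show ?case by simp
qed

lemma leads_move:
  assumes "i \<noteq> o'"
  shows "leads [Loop i [Inc o']] s (s(i := 0, o' := s o' + s i))"
proof (induction "s i" arbitrary: s)
  case 0
  then have eq: "s(i := 0, o' := s o' + s i) = s" by auto
  show ?case unfolding eq by (rule leads_Loop_0) (simp_all add: 0 leads_Nil)
next
  case (Suc n)
  let ?s = "s(i := n, o' := Suc (s o'))"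
  have "leads [Loop i [Inc o']] ?s (?s(i := 0, o' := ?s o' + ?s i))"
    by (rule Suc(1)) (use assms in simp)
  also have "?s(i := 0, o' := ?s o' + ?s i) = s(i := 0, o' := s o' + s i)"
    using assms Suc(2) by (auto simp: fun_eq_iff)
  finally show ?case
    by (rule leads_Loop_Suc[where r = i and n = n, rotated 2])
      (rule Suc(2)[symmetric], rule leads_Inc, rule leads_NilI, use assms in auto)
qed

lemma leads_move2:
  assumes "i \<noteq> o'" "i \<noteq> t" "o' \<noteq> t"
  shows "leads [Loop i [Inc o', Inc t]] s (s(i := 0, o' := s o' + s i, t := s t + s i))"
proof (induction "s i" arbitrary: s)
  case 0
  then have eq: "s(i := 0, o' := s o' + s i, t := s t + s i) = s" by auto
  show ?case unfolding eq by (rule leads_Loop_0) (simp_all add: 0 leads_Nil)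
next
  case (Suc n)
  let ?s = "s(i := n, o' := Suc (s o'), t := Suc (s t))"
  have "leads [Loop i [Inc o', Inc t]] ?s (?s(i := 0, o' := ?s o' + ?s i, t := ?s t + ?s i))"
    by (rule Suc(1)) (use assms in simp)
  also have "?s(i := 0, o' := ?s o' + ?s i, t := ?s t + ?s i) =
      s(i := 0, o' := s o' + s i, t := s t + s i)"
    using assms Suc(2) by (auto simp: fun_eq_iff)
  finally show ?case
    by (rule leads_Loop_Suc[where r = i and n = n, rotated 2])
      (rule Suc(2)[symmetric], rule leads_Inc, rule leads_Inc, rule leads_NilI, use assms in auto)
qed

text \<open>A loop destroys the register it counts down, so the value goes to both \<open>j\<close>
  and the scratch register \<open>t\<close> and is then moved back from \<open>t\<close>.\<close>

definition copy :: "nat \<Rightarrow> nat \<Rightarrow> nat \<Rightarrow> com list" where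
  "copy i j t = [Loop i [Inc j, Inc t], Loop t [Inc i]]"

lemma leads_copy:
  assumes "i \<noteq> j" "i \<noteq> t" "j \<noteq> t" "s t = 0" "s j = 0"
  shows "leads (copy i j t) s (s(j := s i))"
proof -
  let ?s = "s(i := 0, j := s j + s i, t := s t + s i)"
  have "leads (copy i j t) s (?s(t := 0, i := ?s i + ?s t))"
    unfolding copy_def by (rule leads_Cons[OF leads_move2 leads_move]) (use assms in auto)
  moreover have "?s(t := 0, i := ?s i + ?s t) = s(j := s i)"
    using assms by (auto simp: fun_eq_iff)
  ultimately show ?thesis by simp
qed

section \<open>Compiling recursive functions\<close>

text \<open>Takes compiled functions instead of \<open>recf\<close> terms, so that the recursion of
  \<open>compile\<close> goes through \<open>map compile gs\<close>.\<close>

fun gather :: "(nat list \<Rightarrow> nat \<Rightarrow> nat \<Rightarrow> com list) list \<Rightarrow> nat list \<Rightarrow> nat \<Rightarrow> nat \<Rightarrow> com list" where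
  "gather [] is j b = []"
| "gather (F # Fs) is j b = F is j b @ gather Fs is (Suc j) b"

text \<open>\<open>compile p is j b\<close> reads its arguments from the registers \<open>is\<close>, which it preserves, and writes
  the value to \<open>j\<close>, which has to be empty. The registers from \<open>b\<close> on have to be empty as well and
  are left empty.\<close>

fun compile :: "recf \<Rightarrow> nat list \<Rightarrow> nat \<Rightarrow> nat \<Rightarrow> com list" where
  "compile Zero is j b = []"
| "compile Succ is j b = copy (hd is) j b @ [Inc j]"
| "compile (Proj i) is j b = copy (is ! i) j b"
| "compile (Comp f gs) is j b =
     (let bs = [b..<b + length gs]; b' = b + length gs
      in gather (map compile gs) is b b' @ compile f bs j b' @ map clear bs)"
| "compile (PrimRec f g) is j b =
     copy (hd is) b (b + 1) @ compile f (tl is) j (b + 3) @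
     [Loop b (compile g ((b + 1) # j # tl is) (b + 2) (b + 3) @
        [clear j, Loop (b + 2) [Inc j], Inc (b + 1)]),
      clear (b + 1)]"
| "compile (Mu f) is j b =
     compile f (j # is) b (b + 1) @
     [Loop b ([clear b, Inc j] @ compile f (j # is) b (b + 1))]"

text \<open>Nothing is claimed where \<open>p\<close> has no value. As \<open>j\<close> and
  \<open>b\<close> are arbitrary, the code can be placed anywhere among the registers, which the
  inductive cases require.\<close>

definition correct :: "(nat list \<Rightarrow> nat \<Rightarrow> nat \<Rightarrow> com list) \<Rightarrow> recf \<Rightarrow> bool" where
  "correct F p \<longleftrightarrow> (\<forall>is j b s y. eval p (map s is) y \<longrightarrow> (\<forall>i\<in>set is. i < b \<and> i \<noteq> j) \<longrightarrow> j < b \<longrightarrow>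
     s j = 0 \<longrightarrow> (\<forall>r\<ge>b. s r = 0) \<longrightarrow> leads (F is j b) s (s(j := y)))"

lemma correctD:
  assumes "correct F p" "eval p (map s is) y" "\<And>i. i \<in> set is \<Longrightarrow> i < b \<and> i \<noteq> j" "j < b"
    "s j = 0" "\<And>r. b \<le> r \<Longrightarrow> s r = 0"
  shows "leads (F is j b) s (s(j := y))"
  using assms unfolding correct_def by blast

text \<open>The arguments lie below the result block and the scratch area above it, so no result
  overwrites what a later function reads.\<close>

lemma leads_gather:
  assumes "\<And>g. g \<in> set gs \<Longrightarrow> correct (compile g) g"
    and "list_all2 (\<lambda>g y. eval g (map s is) y) gs ys"
    and "\<And>i. i \<in> set is \<Longrightarrow> i < j" and "j + length gs \<le> b"
    and "\<And>r. j \<le> r \<Longrightarrow> s r = 0"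
  shows "leads (gather (map compile gs) is j b) s
    (\<lambda>r. if j \<le> r \<and> r < j + length gs then ys ! (r - j) else s r)"
  using assms
proof (induction gs arbitrary: ys s j)
  case Nil
  have "(\<lambda>r. if j \<le> r \<and> r < j + length [] then ys ! (r - j) else s r) = s" by auto
  then show ?case by (simp add: leads_Nil)
next
  case (Cons g gs)
  from Cons.prems(2) obtain y ys' where ys: "ys = y # ys'" "eval g (map s is) y"
    "list_all2 (\<lambda>g y. eval g (map s is) y) gs ys'"
    by (auto simp: list_all2_Cons1)
  let ?s = "s(j := y)"
  have [simp]: "map ?s is = map s is" using Cons.prems(3) by auto
  have 1: "leads (compile g is j b) s ?s"
    by (rule correctD[OF _ ys(2)]) (use Cons.prems in force)+
  have 2: "leads (gather (map compile gs) is (Suc j) b) ?s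
    (\<lambda>r. if Suc j \<le> r \<and> r < Suc j + length gs then ys' ! (r - Suc j) else ?s r)"
  proof (rule Cons.IH)
    show "list_all2 (\<lambda>g y. eval g (map ?s is) y) gs ys'" using ys(3) by simp
  qed (use Cons.prems in \<open>simp_all add: less_SucI\<close>)
  have "(\<lambda>r. if Suc j \<le> r \<and> r < Suc j + length gs then ys' ! (r - Suc j) else ?s r) =
    (\<lambda>r. if j \<le> r \<and> r < j + length (g # gs) then ys ! (r - j) else s r)"
    by (auto simp: fun_eq_iff ys(1) nth_Cons' Suc_diff_le)
  with leads_append[OF 1 2] show ?case by simp
qed

text \<open>The intermediate values lie in a block taken from the empty area above \<open>b\<close>.
  Clearing it restores the old state there, because it held zeros before.\<close>

lemma correct_Comp:
  assumes "\<And>g. g \<in> set gs \<Longrightarrow> correct (compile g) g" and "correct (compile f) f"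
  shows "correct (compile (Comp f gs)) (Comp f gs)"
  unfolding correct_def
proof (intro allI impI)
  fix "is" j b and s :: "nat \<Rightarrow> nat" and y
  assume "eval (Comp f gs) (map s is) y" and is_less: "\<forall>i\<in>set is. i < b \<and> i \<noteq> j" and "j < b" "s j = 0"
    and zero: "\<forall>r\<ge>b. s r = 0"
  then obtain ys where ys: "list_all2 (\<lambda>g y. eval g (map s is) y) gs ys" "eval f ys y"
    by (auto elim: eval_CompE)
  then have len: "length ys = length gs" by (simp add: list_all2_lengthD)
  let ?b = "b + length gs"
  let ?s = "\<lambda>r. if b \<le> r \<and> r < b + length gs then ys ! (r - b) else s r"
  have 1: "leads (gather (map compile gs) is b ?b) s ?s"
    by (rule leads_gather[OF assms(1) ys(1)]) (use is_less zero in auto)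
  have "map ?s [b..<?b] = ys"
    by (rule nth_equalityI) (use len in auto)
  with ys(2) have 2: "leads (compile f [b..<?b] j ?b) ?s (?s(j := y))"
    by (intro correctD[OF assms(2)]) (use zero \<open>j < b\<close> \<open>s j = 0\<close> in auto)
  let ?t = "\<lambda>r. if r \<in> set [b..<?b] then 0 else (?s(j := y)) r"
  have "?t = s(j := y)"
    using zero \<open>j < b\<close> by (auto simp: fun_eq_iff)
  with leads_append[OF leads_append[OF 1 2] leads_clear_list[of "[b..<?b]"]]
  show "leads (compile (Comp f gs) is j b) s (s(j := y))"
    by (simp add: Let_def)
qed

text \<open>Register \<open>b\<close> counts the iterations left, \<open>b + 1\<close> is the
  current index, and \<open>j\<close> holds the current value. As \<open>j\<close> is an argument of
  \<open>g\<close>, the next value is first written to \<open>b + 2\<close> and then moved.\<close>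

lemma correct_PrimRec:
  assumes f: "correct (compile f) f" and g: "correct (compile g) g"
  shows "correct (compile (PrimRec f g)) (PrimRec f g)"
  unfolding correct_def
proof (intro allI impI)
  fix "is" j b and s :: "nat \<Rightarrow> nat" and y
  assume ev: "eval (PrimRec f g) (map s is) y" and is_less: "\<forall>i\<in>set is. i < b \<and> i \<noteq> j"
    and j: "j < b" "s j = 0" and zero: "\<forall>r\<ge>b. s r = 0"
  from ev obtain i0 xs where "is": "is = i0 # xs"
    by (cases "is") (auto elim: eval.cases)
  define body where "body = compile g ((b + 1) # j # xs) (b + 2) (b + 3) @
        [clear j, Loop (b + 2) [Inc j], Inc (b + 1)]"
  define st where "st m n y = s(b := m, b + 1 := n, j := y)" for m n y
  have st_xs: "map (st m n y) xs = map s xs" for m n y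
    using is_less by (auto simp: st_def "is")
  have st_app: "st m n y j = y" "st m n y (Suc b) = n" "r > Suc b \<Longrightarrow> st m n y r = 0" for m n y r
    using j zero by (auto simp: st_def)
  have body: "leads body (st m n y) (st m (Suc n) z)" if "eval g (n # y # map s xs) z" for m n y z
  proof -
    have 1: "leads (compile g ((b + 1) # j # xs) (b + 2) (b + 3)) (st m n y) ((st m n y)(b + 2 := z))"
      by (rule correctD[OF g])
        (use that is_less j in \<open>auto simp: st_xs st_app "is"\<close>)
    have 2: "leads [clear j, Loop (b + 2) [Inc j], Inc (b + 1)] ((st m n y)(b + 2 := z)) (st m (Suc n) z)"
    proof (rule leads_Cons[OF leads_clear leads_Cons[OF leads_move leads_Inc]])
      let ?s = "((st m n y)(b + 2 := z))(j := 0)"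
      let ?t = "?s(b + 2 := 0, j := ?s j + ?s (b + 2))"
      have "?t(b + 1 := Suc (?t (b + 1))) = st m (Suc n) z"
        using j zero by (auto simp: st_def fun_eq_iff)
      then show "leads [] (?t(b + 1 := Suc (?t (b + 1)))) (st m (Suc n) z)"
        by (simp only: leads_Nil)
    qed (use j in simp)
    show ?thesis unfolding body_def by (rule leads_append[OF 1 2])
  qed
  \<comment> \<open>The loop is unwound backwards along the evaluation: the state with index
    \<open>n\<close> and \<open>m\<close> iterations left is traced back to index 0 with
    \<open>n + m\<close> left. The value \<open>y0\<close> of the base case is obtained on the
    way.\<close>
  have loop: "\<exists>y0. eval f (map s xs) y0 \<and> (\<forall>m cs s'. leads (Loop b body # cs) (st m n y) s' \<longrightarrow>
      leads (Loop b body # cs) (st (n + m) 0 y0) s')"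
    if "eval (PrimRec f g) (n # map s xs) y" for n y
    using that
  proof (induction n arbitrary: y)
    case 0
    then show ?case by (auto elim: eval_PrimRec_0E)
  next
    case (Suc n)
    then obtain y' where y': "eval (PrimRec f g) (n # map s xs) y'" "eval g (n # y' # map s xs) y"
      by (auto elim: eval_PrimRec_SucE)
    from Suc.IH[OF y'(1)] obtain y0 where y0: "eval f (map s xs) y0"
      "\<And>m cs s'. leads (Loop b body # cs) (st m n y') s' \<Longrightarrow>
        leads (Loop b body # cs) (st (n + m) 0 y0) s'"
      by blast
    have "leads (Loop b body # cs) (st (Suc n + m) 0 y0) s'"
      if "leads (Loop b body # cs) (st m (Suc n) y) s'" for m cs s'
    proof -
      have upd: "(st (Suc m) n y')(b := m) = st m n y'" "st (Suc m) n y' b = Suc m"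
        using j by (auto simp: st_def)
      have "leads (Loop b body # cs) (st (Suc m) n y') s'"
        using upd body[OF y'(2), of m] that
        by (auto intro: leads_Loop_Suc[where r = b and n = m and s' = "st m (Suc n) y"])
      from y0(2)[OF this] show ?thesis by simp
    qed
    with y0(1) show ?case by blast
  qed
  from loop[of "s i0" y] ev obtain y0 where y0: "eval f (map s xs) y0"
    "\<And>m cs s'. leads (Loop b body # cs) (st m (s i0) y) s' \<Longrightarrow>
      leads (Loop b body # cs) (st (s i0 + m) 0 y0) s'"
    by (auto simp: "is")
  have 1: "leads (copy i0 b (b + 1)) s (s(b := s i0))"
    by (rule leads_copy) (use is_less zero in \<open>auto simp: "is"\<close>)
  have map_s: "map (s(b := s i0)) xs = map s xs"
    using is_less by (auto simp: "is")
  have 2: "leads (compile f xs j (b + 3)) (s(b := s i0)) ((s(b := s i0))(j := y0))"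
    by (rule correctD[OF f]) (use y0(1) is_less zero j map_s in \<open>auto simp: "is"\<close>)
  have 3: "(s(b := s i0))(j := y0) = st (s i0 + 0) 0 y0"
    using zero j by (auto simp: st_def fun_eq_iff)
  have 4: "(st 0 (s i0) y)(b + 1 := 0) = s(j := y)"
    using zero j by (auto simp: st_def fun_eq_iff)
  have "leads [Loop b body, clear (b + 1)] (st (s i0 + 0) 0 y0) (s(j := y))"
    by (rule y0(2), rule leads_Loop_0) (use j leads_clear[of "b + 1" "st 0 (s i0) y"] 4 in \<open>auto simp: st_def\<close>)
  with leads_append[OF 1 leads_append[OF 2, unfolded 3]]
  show "leads (compile (PrimRec f g) is j b) s (s(j := y))"
    by (simp add: "is" body_def)
qed

text \<open>The result register \<open>j\<close> itself is the search index, and \<open>b\<close>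
  receives the value of \<open>f\<close> there. The loop is left when this value is zero.\<close>

lemma correct_Mu:
  assumes f: "correct (compile f) f"
  shows "correct (compile (Mu f)) (Mu f)"
  unfolding correct_def
proof (intro allI impI)
  fix "is" j b and s :: "nat \<Rightarrow> nat" and n
  assume ev: "eval (Mu f) (map s is) n" and is_less: "\<forall>i\<in>set is. i < b \<and> i \<noteq> j"
    and j: "j < b" "s j = 0" and zero: "\<forall>r\<ge>b. s r = 0"
  let ?c = "compile f (j # is) b (b + 1)"
  define st where "st m y = s(j := m, b := y)" for m y
  have st_is: "map (st m y) is = map s is" for m y
    using is_less by (auto simp: st_def)
  have st_app: "st m y j = m" "st m y b = y" "r > b \<Longrightarrow> st m y r = 0" for m y r
    using j zero by (auto simp: st_def)
  have c: "leads ?c (st m 0) (st m y)" if "eval f (m # map s is) y" for m y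
  proof -
    have "leads ?c (st m 0) ((st m 0)(b := y))"
      by (rule correctD[OF f]) (use that is_less zero j in \<open>auto simp: st_is st_app\<close>)
    then show ?thesis by (simp add: st_def)
  qed
  have n: "eval f (n # map s is) 0" "\<And>m. m < n \<Longrightarrow> \<exists>y>0. eval f (m # map s is) y"
    using ev by (auto elim: eval_MuE)
  let ?L = "[Loop b ([clear b, Inc j] @ ?c)]"
  have fin: "st n 0 = s(j := n)" and ini: "st 0 0 = s"
    using zero j by (auto simp: st_def fun_eq_iff)
  \<comment> \<open>Downward induction from \<open>n\<close>: the loop stops at \<open>n\<close>,
    and at every smaller index the value is positive, which makes the loop advance.\<close>
  have loop: "leads ?L (st m y) (s(j := n))" if "m \<le> n" "eval f (m # map s is) y" for m y
    using that
  proof (induction m arbitrary: y rule: inc_induct)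
    case base
    with n(1) have "y = 0" by (simp add: eval_deterministic)
    then show ?case
      using j zero by (intro leads_Loop_0) (simp_all add: fin leads_Nil)
  next
    case (step m)
    from n(2)[OF step.hyps(2)] step.prems obtain k where k: "y = Suc k"
      using eval_deterministic not0_implies_Suc by blast
    obtain y' where y': "eval f (Suc m # map s is) y'"
      using n step.hyps(2) by (cases "Suc m = n") (auto, metis Suc_lessI)
    have "leads ([clear b, Inc j] @ ?c) ((st m y)(b := k)) (st (Suc m) y')"
    proof (rule leads_append[OF _ c[OF y']])
      have "(((st m y)(b := k))(b := 0))(j := Suc ((((st m y)(b := k))(b := 0)) j)) = st (Suc m) 0"
        using j by (auto simp: st_def)
      then show "leads [clear b, Inc j] ((st m y)(b := k)) (st (Suc m) 0)"
        by (intro leads_Cons[OF leads_clear] leads_Inc) (simp add: leads_Nil)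
    qed
    then show ?case
      by (rule leads_Loop_Suc[rotated, OF _ step.IH[OF y']]) (simp add: st_app k)
  qed
  obtain y where y: "eval f (0 # map s is) y"
    using n by (cases n) auto
  from leads_append[OF c[OF y] loop[OF _ y]]
  show "leads (compile (Mu f) is j b) s (s(j := n))"
    by (simp add: ini)
qed

lemma compile_correct: "correct (compile p) p"
proof (induction p)
  case Zero
  have "s(j := y) = s" if "eval Zero xs y" "s j = 0" for s :: "nat \<Rightarrow> nat" and j xs y
    using that by (metis eval_ZeroE fun_upd_triv)
  then show ?case by (simp add: correct_def leads_Nil)
next
  case Succ
  show ?case
    unfolding correct_def
  proof (intro allI impI)
    fix "is" j b and s :: "nat \<Rightarrow> nat" and y
    assume "eval Succ (map s is) y" and is_less: "\<forall>i\<in>set is. i < b \<and> i \<noteq> j" and "j < b" "s j = 0"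
      and zero: "\<forall>r\<ge>b. s r = 0"
    then obtain i where i: "is = [i]" "y = Suc (s i)" by (auto elim: eval_SuccE)
    have "leads (copy i j b @ [Inc j]) s (s(j := y))"
      by (rule leads_append[OF leads_copy leads_Inc])
        (use is_less zero \<open>j < b\<close> \<open>s j = 0\<close> in \<open>auto simp: i leads_Nil\<close>)
    then show "leads (compile Succ is j b) s (s(j := y))" by (simp add: i)
  qed
next
  case (Proj i)
  show ?case
    unfolding correct_def
  proof (intro allI impI)
    fix "is" j b and s :: "nat \<Rightarrow> nat" and y
    assume "eval (Proj i) (map s is) y" and is_less: "\<forall>i\<in>set is. i < b \<and> i \<noteq> j" and "j < b" "s j = 0"
      and zero: "\<forall>r\<ge>b. s r = 0"
    then have i: "i < length is" "y = s (is ! i)" by (auto elim: eval_ProjE)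
    have "leads (copy (is ! i) j b) s (s(j := s (is ! i)))"
      by (rule leads_copy) (use is_less zero \<open>j < b\<close> \<open>s j = 0\<close> i in \<open>auto dest: nth_mem\<close>)
    then show "leads (compile (Proj i) is j b) s (s(j := y))" by (simp add: i)
  qed
qed (simp_all only: correct_Comp correct_PrimRec correct_Mu)

section \<open>Control points\<close>

text \<open>A control point is the list of commands still to be executed, with \<open>ks\<close> as
  continuation after \<open>cs\<close>. Unfolding a loop puts its body in front of the same loop, so
  finitely many lists suffice.\<close>

fun points :: "com list \<Rightarrow> com list \<Rightarrow> com list set" where
  "points [] ks = {ks}"
| "points (Inc r # cs) ks = insert (Inc r # cs @ ks) (points cs ks)"
| "points (Loop r b # cs) ks =
     insert (Loop r b # cs @ ks) (points b (Loop r b # cs @ ks) \<union> points cs ks)"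

fun succs :: "com list \<Rightarrow> com list set" where
  "succs [] = {}"
| "succs (Inc r # ks) = {ks}"
| "succs (Loop r b # ks) = {ks, b @ Loop r b # ks}"

lemma finite_points: "finite (points cs ks)"
  by (induction cs ks rule: points.induct) auto

lemma append_in_points: "cs @ ks \<in> points cs ks"
  by (induction cs ks rule: points.induct) auto

lemma exit_in_points: "ks \<in> points cs ks"
  by (induction cs ks rule: points.induct) auto

text \<open>The exit \<open>ks\<close> is exempt because its successors belong to the surrounding
  program; for \<open>ks = []\<close> it has none.\<close>

lemma succs_points: "js \<in> points cs ks \<Longrightarrow> js = ks \<or> succs js \<subseteq> points cs ks"
proof (induction cs ks rule: points.induct)
  case (2 r cs ks)
  then show ?case using append_in_points by auto
next
  case (3 r b cs ks)
  let ?ks = "Loop r b # cs @ ks"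
  have "succs ?ks \<subseteq> points (Loop r b # cs) ks"
    using append_in_points[of cs ks] append_in_points[of b ?ks] by auto
  with 3 show ?case by auto
qed auto

fun reg :: "com \<Rightarrow> nat" where
  "reg (Inc r) = r"
| "reg (Loop r b) = r"

section \<open>Simulation by register set automata\<close>

text \<open>The restrictions yield the extensional functions on \<open>R\<close> that
  \<open>is_transition\<close> demands.\<close>

definition mk_transition ::
  "nat set \<Rightarrow> nat \<Rightarrow> 'a \<Rightarrow> nat set \<Rightarrow> nat set \<Rightarrow> (nat \<Rightarrow> nat set) \<Rightarrow> (nat \<Rightarrow> nat source set) \<Rightarrow> nat \<Rightarrow>
   (nat, 'a, nat) transition" where
  "mk_transition R q a G N E u q' =
     \<lparr>src = q, letter = a, gin = G, gnotin = N, geq = restrict E R, upd = restrict u R, tgt = q'\<rparr>"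

text \<open>Registers from \<open>n\<close> on are emptied, not kept: with \<open>n\<close> fixed,
  the code of a control transition is then the same for every sufficiently large register
  set.\<close>

definition keep :: "nat \<Rightarrow> nat \<Rightarrow> nat source set" where
  "keep n r = (if r < n then {Reg r} else {})"

text \<open>Counter \<open>r\<close> has \<open>2 * r\<close> for U and \<open>2 * r + 1\<close> for
  V. In the positive branch of a loop the datum read witnesses that U - V is nonempty; the other
  branch is the equality test.\<close>

fun instr :: "nat set \<Rightarrow> 'a \<Rightarrow> nat \<Rightarrow> (com list \<Rightarrow> nat) \<Rightarrow> com list \<Rightarrow> (nat, 'a, nat) transition set" where
  "instr R a k h [] = {}"
| "instr R a k h (Inc r # ks) =
     {mk_transition R (h (Inc r # ks)) a {} {2 * r} (\<lambda>_. {})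
        ((keep (2 * k))(2 * r := {Reg (2 * r), In})) (h ks)}"
| "instr R a k h (Loop r b # ks) =
     {mk_transition R (h (Loop r b # ks)) a {2 * r} {2 * r + 1} (\<lambda>_. {})
        ((keep (2 * k))(2 * r + 1 := {Reg (2 * r + 1), In})) (h (b @ Loop r b # ks)),
      mk_transition R (h (Loop r b # ks)) a {} {} ((\<lambda>_. {})(2 * r := {2 * r + 1})) (keep (2 * k)) (h ks)}"

text \<open>In state \<open>x + i\<close> there are \<open>i\<close> data still to be loaded.
  Register 0 is the U of counter 0, and requiring a datum outside it makes the loaded data
  distinct.\<close>

definition load :: "'a \<Rightarrow> nat \<Rightarrow> nat \<Rightarrow> (nat, 'a, nat) transition" where
  "load a x i = mk_transition {..<x} (Suc (x + i)) a {} {0} (\<lambda>_. {}) ((\<lambda>_. {})(0 := {Reg 0, In})) (x + i)"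

definition jump :: "'a \<Rightarrow> nat \<Rightarrow> (nat, 'a, nat) transition" where
  "jump a x = mk_transition {..<x} x a {} {} (\<lambda>_. {}) ((\<lambda>_. {})(0 := {Reg 0})) 1"

text \<open>An unreachable loop, which forces the code of the control part to exceed \<open>B\<close>.\<close>

definition idle :: "nat set \<Rightarrow> 'a \<Rightarrow> nat \<Rightarrow> (nat, 'a, nat) transition" where
  "idle R a B = mk_transition R B a {} {} (\<lambda>_. {}) (\<lambda>_. {}) B"

text \<open>Finiteness ensures a fresh datum for every increment and excludes the default value 0
  that \<open>card\<close> gives to infinite sets.\<close>

definition repr :: "'d set \<Rightarrow> nat \<Rightarrow> (nat \<Rightarrow> 'd set) \<Rightarrow> (nat \<Rightarrow> nat) \<Rightarrow> bool" where
  "repr D k f s \<longleftrightarrow> (\<forall>r<k. f (2 * r + 1) \<subseteq> f (2 * r) \<and> f (2 * r) \<subseteq> D \<and> finite (f (2 * r)) \<and>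
     card (f (2 * r) - f (2 * r + 1)) = s r)"

lemma run_append: "run A cf v cf' \<Longrightarrow> run A cf' w cf'' \<Longrightarrow> run A cf (v @ w) cf''"
  by (induction rule: run.induct) (auto intro: run.intros)

lemma is_transition_mk_transition:
  assumes "q \<in> Q" "q' \<in> Q" "a \<in> \<Sigma>" "G \<subseteq> R" "N \<subseteq> R" "\<And>r. r \<in> R \<Longrightarrow> E r \<subseteq> R"
    "\<And>r. r \<in> R \<Longrightarrow> u r \<subseteq> insert In (Reg ` R)"
  shows "is_transition \<Sigma> Q R (mk_transition R q a G N E u q')"
  using assms by (simp add: is_transition_def mk_transition_def PiE_iff)

lemma update_mk_transition:
  "update R (mk_transition R' q a G N E u q') f d r =
     (if r \<in> R then (\<Union>r'\<in>{r'\<in>R. Reg r' \<in> restrict u R' r}. f r') \<union> (if In \<in> restrict u R' r then {d} else {})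
      else undefined)"
  by (simp add: update_def mk_transition_def)

text \<open>The numbering \<open>h\<close> turns control points into states, with 0 for termination
  and 1 for the start. The bound \<open>B\<close> lies above these states and above the
  \<open>2 * k\<close> registers of the \<open>k\<close> counters.\<close>

locale counter_automaton =
  fixes D :: "'d set" and \<Sigma> :: "'a set" and a :: 'a and prog :: "com list" and h :: "com list \<Rightarrow> nat"
    and k B :: nat
  assumes infinite_D: "infinite D" and a: "a \<in> \<Sigma>"
    and inj_h: "inj_on h (points prog [])"
    and h_Nil: "h [] = 0" and h_prog: "h prog = 1"
    and h_less: "ks \<in> points prog [] \<Longrightarrow> h ks < B"
    and reg_less: "c # ks \<in> points prog [] \<Longrightarrow> reg c < k"
    and k_less: "2 * k < B" and k_pos: "0 < k"
begin

definition control :: "nat set \<Rightarrow> (nat, 'a, nat) transition set" where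
  "control R = insert (idle R a B) (\<Union>ks\<in>points prog []. instr R a k h ks)"

text \<open>The number \<open>x\<close> is at once the value to load, the number of registers and
  the least loading state. Hence everything outside the control part is determined by
  \<open>x\<close> and the letter \<open>a\<close>.\<close>

definition automaton :: "nat \<Rightarrow> (nat, 'a, nat) rsa" where
  "automaton x = \<lparr>States = {..2 * x}, Regs = {..<x},
     Trans = control {..<x} \<union> insert (jump a x) (load a x ` {..<x}), Init = {2 * x}, Final = {0}\<rparr>"

lemma points_closed: "js \<in> points prog [] \<Longrightarrow> succs js \<subseteq> points prog []"
  using succs_points[of js prog "[]"] by auto

lemma is_rsa_automaton:
  assumes "B < x"
  shows "is_rsa \<Sigma> (automaton x)"
proof -
  have keep: "keep (2 * k) r \<subseteq> insert In (Reg ` {..<x})" for r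
    using assms k_less by (auto simp: keep_def)
  have "is_transition \<Sigma> {..2 * x} {..<x} t" if t: "t \<in> instr {..<x} a k h ks" and ks: "ks \<in> points prog []" for t ks
  proof -
    have less: "h js \<le> 2 * x" if "js \<in> insert ks (succs ks)" for js
    proof -
      have "h js < B" using that points_closed[OF ks] ks h_less by blast
      with assms show ?thesis by simp
    qed
    show ?thesis
    proof (cases ks rule: succs.cases)
      case 1
      with t show ?thesis by simp
    next
      case (2 r js)
      then have "r < k" using ks reg_less by fastforce
      then have r: "2 * r < x" using k_less assms by simp
      have le: "h ks \<le> 2 * x" "h js \<le> 2 * x" using 2 less by simp_all
      from t 2 have "t = mk_transition {..<x} (h ks) a {} {2 * r} (\<lambda>_. {})
        ((keep (2 * k))(2 * r := {Reg (2 * r), In})) (h js)"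
        by simp
      then show ?thesis
        using a r le keep by (simp add: is_transition_mk_transition)
    next
      case (3 r b js)
      then have "r < k" using ks reg_less by fastforce
      then have r: "2 * r < x" "2 * r + 1 < x" using k_less assms by simp_all
      have le: "h ks \<le> 2 * x" "h js \<le> 2 * x" "h (b @ Loop r b # js) \<le> 2 * x" using 3 less by simp_all
      from t 3 consider
        "t = mk_transition {..<x} (h ks) a {2 * r} {2 * r + 1} (\<lambda>_. {})
          ((keep (2 * k))(2 * r + 1 := {Reg (2 * r + 1), In})) (h (b @ Loop r b # js))" |
        "t = mk_transition {..<x} (h ks) a {} {} ((\<lambda>_. {})(2 * r := {2 * r + 1})) (keep (2 * k)) (h js)"
        by auto
      then show ?thesis
        by cases (use a r le keep in \<open>simp_all add: is_transition_mk_transition\<close>)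
    qed
  qed
  moreover have "is_transition \<Sigma> {..2 * x} {..<x} (idle {..<x} a B)"
    "is_transition \<Sigma> {..2 * x} {..<x} (jump a x)"
    using a assms unfolding idle_def jump_def by (simp_all add: is_transition_mk_transition)
  moreover have "is_transition \<Sigma> {..2 * x} {..<x} (load a x i)" if "i < x" for i
    using a that unfolding load_def by (simp add: is_transition_mk_transition)
  ultimately show ?thesis
    by (auto simp: is_rsa_def automaton_def control_def)
qed

section \<open>Counter operations on pairs of registers\<close>

lemma repr_inc:
  assumes "repr D k f s" "r < k" "d \<in> D" "d \<notin> f (2 * r)"
    and "\<And>i. i < 2 * k \<Longrightarrow> f' i = (if i = 2 * r then insert d (f i) else f i)"
  shows "repr D k f' (s(r := Suc (s r)))"
proof -
  have "insert d (f (2 * r)) - f (2 * r + 1) = insert d (f (2 * r) - f (2 * r + 1))"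
    using assms unfolding repr_def by blast
  moreover have "finite (f (2 * r) - f (2 * r + 1))"
    using assms unfolding repr_def by blast
  ultimately have "card (insert d (f (2 * r)) - f (2 * r + 1)) = Suc (s r)"
    using assms unfolding repr_def by simp
  moreover have "2 * r' + 1 \<noteq> 2 * r" for r' :: nat
    by presburger
  ultimately show ?thesis
    using assms unfolding repr_def by auto
qed

lemma repr_dec:
  assumes "repr D k f s" "r < k" "d \<in> f (2 * r)" "d \<notin> f (2 * r + 1)"
    and "\<And>i. i < 2 * k \<Longrightarrow> f' i = (if i = 2 * r + 1 then insert d (f i) else f i)"
  shows "\<exists>n. s r = Suc n \<and> repr D k f' (s(r := n))"
proof -
  have "f (2 * r) - insert d (f (2 * r + 1)) = (f (2 * r) - f (2 * r + 1)) - {d}" by blast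
  moreover have "finite (f (2 * r) - f (2 * r + 1))" "d \<in> f (2 * r) - f (2 * r + 1)"
    using assms unfolding repr_def by blast+
  ultimately have "Suc (card (f (2 * r) - insert d (f (2 * r + 1)))) = s r"
    using assms unfolding repr_def by (metis card_Suc_Diff1)
  moreover have "2 * r' + 1 \<noteq> 2 * r" "2 * r \<noteq> 2 * r' + 1" for r' :: nat
    by presburger+
  ultimately show ?thesis
    using assms unfolding repr_def by (intro exI[of _ "s r - 1"]) auto
qed

lemma repr_zero:
  assumes "repr D k f s" "r < k"
  shows "f (2 * r + 1) = f (2 * r) \<longleftrightarrow> s r = 0"
  using assms unfolding repr_def by (metis Diff_eq_empty_iff card_0_eq card.empty finite_Diff order_antisym)

lemma repr_cong: "repr D k f s \<Longrightarrow> (\<And>i. i < 2 * k \<Longrightarrow> f' i = f i) \<Longrightarrow> repr D k f' s"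
  unfolding repr_def by auto

context
  fixes x :: nat
  assumes x: "B < x"
begin

abbreviation "A \<equiv> automaton x"

lemma Regs_A: "Regs A = {..<x}" and Trans_A: "Trans A = control {..<x} \<union> insert (jump a x) (load a x ` {..<x})"
  by (simp_all add: automaton_def)

lemma update_keep:
  assumes "d \<in> D" "i < 2 * k" "j < 2 * k"
  shows "update {..<x} (mk_transition {..<x} q a G N E (keep (2 * k)) q') f d i = f i"
    "update {..<x} (mk_transition {..<x} q a G N E ((keep (2 * k))(j := {Reg j, In})) q') f d i =
      (if i = j then insert d (f i) else f i)"
  using assms x k_less by (auto simp: update_mk_transition keep_def)

section \<open>From halting computations to accepting runs\<close>

lemma halts_run:
  assumes "halts ks s" "ks \<in> points prog []" "repr D k f s"
  shows "\<exists>w\<in>lists (\<Sigma> \<times> D). \<exists>f'. run A (h ks, f) w (0, f')"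
  using assms
proof (induction arbitrary: f)
  case (halts_Nil s)
  show ?case by (rule bexI[of _ "[]"]) (auto simp: h_Nil intro: run_Nil)
next
  case (halts_Inc ks s r)
  have r: "r < k" and ks: "ks \<in> points prog []"
    using reg_less halts_Inc.prems(1) points_closed[OF halts_Inc.prems(1)] by force+
  \<comment> \<open>Finiteness of U leaves a fresh datum in the infinite domain.\<close>
  have "finite (f (2 * r))" using halts_Inc.prems(2) r by (auto simp: repr_def)
  then obtain d where d: "d \<in> D" "d \<notin> f (2 * r)"
    using infinite_D by (metis finite_subset subsetI)
  let ?t = "mk_transition {..<x} (h (Inc r # ks)) a {} {2 * r} (\<lambda>_. {})
        ((keep (2 * k))(2 * r := {Reg (2 * r), In})) (h ks)"
  let ?f = "update {..<x} ?t f d"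
  have "repr D k ?f (s(r := Suc (s r)))"
    by (rule repr_inc[OF halts_Inc.prems(2) r d]) (use r d update_keep in auto)
  from halts_Inc.IH[OF ks this] obtain w f' where "w \<in> lists (\<Sigma> \<times> D)" "run A (h ks, ?f) w (0, f')"
    by blast
  moreover have "step A (h (Inc r # ks), f) (a, d) (h ks, ?f)"
    unfolding step_def
  proof (rule bexI[of _ ?t])
    show "?t \<in> Trans A" using halts_Inc.prems(1) by (force simp: Trans_A control_def)
  qed (use d in \<open>auto simp: enabled_def mk_transition_def Regs_A\<close>)
  ultimately show ?case
    using a d by (intro bexI[of _ "(a, d) # w"]) (auto intro: run_Cons)
next
  case (halts_Loop_0 s r ks b)
  have r: "r < k" and ks: "ks \<in> points prog []"
    using reg_less halts_Loop_0.prems(1) points_closed[OF halts_Loop_0.prems(1)] by force+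
  \<comment> \<open>The zero test also reads a letter, but its datum is ignored, so any element of
    \<open>D\<close> serves.\<close>
  obtain d where d: "d \<in> D"
    using infinite_D by (metis finite.emptyI ex_in_conv)
  let ?t = "mk_transition {..<x} (h (Loop r b # ks)) a {} {} ((\<lambda>_. {})(2 * r := {2 * r + 1}))
    (keep (2 * k)) (h ks)"
  let ?f = "update {..<x} ?t f d"
  have "repr D k ?f s"
    by (rule repr_cong[OF halts_Loop_0.prems(2)]) (use d update_keep in auto)
  from halts_Loop_0.IH[OF ks this] obtain w f' where "w \<in> lists (\<Sigma> \<times> D)" "run A (h ks, ?f) w (0, f')"
    by blast
  moreover have "step A (h (Loop r b # ks), f) (a, d) (h ks, ?f)"
    unfolding step_def
  proof (rule bexI[of _ ?t])
    show "?t \<in> Trans A" using halts_Loop_0.prems(1) by (force simp: Trans_A control_def)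
  qed (use repr_zero[OF halts_Loop_0.prems(2) r] halts_Loop_0.hyps(1) in
      \<open>auto simp: enabled_def mk_transition_def Regs_A\<close>)
  ultimately show ?case
    using a d by (intro bexI[of _ "(a, d) # w"]) (auto intro: run_Cons)
next
  case (halts_Loop_Suc s r n b ks)
  have r: "r < k" and ks: "b @ Loop r b # ks \<in> points prog []"
    using reg_less halts_Loop_Suc.prems(1) points_closed[OF halts_Loop_Suc.prems(1)] by force+
  \<comment> \<open>As U and V differ and V is contained in U, some datum of U - V is available for
    the decrement.\<close>
  have "f (2 * r + 1) \<noteq> f (2 * r)" "f (2 * r + 1) \<subseteq> f (2 * r)" "f (2 * r) \<subseteq> D"
    using repr_zero[OF halts_Loop_Suc.prems(2) r] halts_Loop_Suc.hyps(1) halts_Loop_Suc.prems(2) r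
    by (auto simp: repr_def)
  then obtain d where d: "d \<in> D" "d \<in> f (2 * r)" "d \<notin> f (2 * r + 1)"
    by blast
  let ?t = "mk_transition {..<x} (h (Loop r b # ks)) a {2 * r} {2 * r + 1} (\<lambda>_. {})
        ((keep (2 * k))(2 * r + 1 := {Reg (2 * r + 1), In})) (h (b @ Loop r b # ks))"
  let ?f = "update {..<x} ?t f d"
  have "\<exists>n. s r = Suc n \<and> repr D k ?f (s(r := n))"
    by (rule repr_dec[OF halts_Loop_Suc.prems(2) r d(2,3)]) (use r d update_keep in auto)
  then have "repr D k ?f (s(r := n))" using halts_Loop_Suc.hyps(1) by simp
  from halts_Loop_Suc.IH[OF ks this] obtain w f' where "w \<in> lists (\<Sigma> \<times> D)"
    "run A (h (b @ Loop r b # ks), ?f) w (0, f')"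
    by blast
  moreover have "step A (h (Loop r b # ks), f) (a, d) (h (b @ Loop r b # ks), ?f)"
    unfolding step_def
  proof (rule bexI[of _ ?t])
    show "?t \<in> Trans A" using halts_Loop_Suc.prems(1) by (force simp: Trans_A control_def)
  qed (use d in \<open>auto simp: enabled_def mk_transition_def Regs_A\<close>)
  ultimately show ?case
    using a d by (intro bexI[of _ "(a, d) # w"]) (auto intro: run_Cons)
qed

section \<open>The loading phase\<close>

definition loaded :: "(nat \<Rightarrow> 'd set) \<Rightarrow> nat \<Rightarrow> bool" where
  "loaded f n \<longleftrightarrow> f 0 \<subseteq> D \<and> finite (f 0) \<and> card (f 0) = n \<and> (\<forall>r<x. r > 0 \<longrightarrow> f r = {})"

lemma loaded_repr: "loaded f n \<Longrightarrow> repr D k f ((\<lambda>_. 0)(0 := n))"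
  using x k_less by (auto simp: loaded_def repr_def)

text \<open>Sources of control transitions are at most \<open>B\<close>, hence below the loading
  states, so only \<open>load\<close> and \<open>jump\<close> can apply. This serves both to build
  loading runs and to analyse arbitrary ones.\<close>

lemma step_load:
  assumes "step A (q, f) (b, d) (q', f')" "q = x + i" "i \<le> x" "loaded f (x - i)" "d \<in> D"
  shows "i = 0 \<and> q' = 1 \<and> loaded f' x \<or> (\<exists>j. i = Suc j \<and> q' = x + j \<and> loaded f' (x - j))"
proof -
  from assms(1) obtain t where t: "t \<in> Trans A" "src t = q" "enabled {..<x} t f d"
    "q' = tgt t" "f' = update {..<x} t f d"
    by (auto simp: step_def Regs_A)
  have "src t < x" if "t \<in> control {..<x}"
  proof -
    have "src t = h ks" if "t \<in> instr {..<x} a k h ks" for ks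
      using that by (cases ks rule: succs.cases) (auto simp: mk_transition_def)
    with that x h_less show ?thesis
      by (fastforce simp: control_def idle_def mk_transition_def)
  qed
  with t(1,2) assms(2) consider "t = jump a x" | j where "t = load a x j" "j < x"
    by (auto simp: Trans_A)
  then show ?thesis
  proof cases
    case 1
    then have "i = 0" "q' = 1"
      using t(2,4) assms(2) by (simp_all add: jump_def mk_transition_def)
    moreover have "{r. r = 0 \<and> r < x} = {0}" using x by auto
    then have "f' 0 = f 0" "\<forall>r<x. r > 0 \<longrightarrow> f' r = {}"
      using x by (auto simp: t(5) 1 jump_def update_mk_transition)
    ultimately show ?thesis using assms(4) by (simp add: loaded_def)
  next
    case 2
    have i: "i = Suc j" using 2 t(2) assms(2) by (simp add: load_def mk_transition_def)
    have "d \<notin> f 0" using t(3) 2 by (simp add: load_def mk_transition_def enabled_def)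
    moreover have "f' 0 = insert d (f 0)" "\<forall>r<x. r > 0 \<longrightarrow> f' r = {}"
      using x by (auto simp: t(5) 2 load_def update_mk_transition)
    ultimately have "loaded f' (x - j)"
      using assms(3-5) i by (auto simp: loaded_def Suc_diff_Suc)
    then show ?thesis using i t(4) 2 by (simp add: load_def mk_transition_def)
  qed
qed

lemma run_load:
  assumes "i \<le> x" "loaded f (x - i)"
  shows "\<exists>w\<in>lists (\<Sigma> \<times> D). \<exists>f'. loaded f' x \<and> run A (x + i, f) w (1, f')"
  using assms
proof (induction i arbitrary: f)
  case 0
  obtain d where d: "d \<in> D"
    using infinite_D by (metis finite.emptyI ex_in_conv)
  let ?f = "update {..<x} (jump a x) f d"
  have step: "step A (x + 0, f) (a, d) (1, ?f)"
    unfolding step_def by (rule bexI[of _ "jump a x"])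
      (auto simp: Trans_A Regs_A enabled_def, simp_all add: jump_def mk_transition_def)
  from step_load[OF this refl 0 d] have "loaded ?f x" by simp
  with step a d show ?case
    by (intro bexI[of _ "[(a, d)]"] exI[of _ ?f]) (auto intro: run_Cons run_Nil)
next
  case (Suc i)
  obtain d where d: "d \<in> D" "d \<notin> f 0"
    using infinite_D Suc.prems(2) unfolding loaded_def by (metis finite_subset subsetI)
  let ?f = "update {..<x} (load a x i) f d"
  have step: "step A (x + Suc i, f) (a, d) (x + i, ?f)"
    unfolding step_def by (rule bexI[of _ "load a x i"])
      (use Suc.prems(1) d in \<open>auto simp: Trans_A Regs_A enabled_def load_def mk_transition_def\<close>)
  from step_load[OF this refl Suc.prems d(1)] have "loaded ?f (x - i)" by simp
  with Suc.IH[of ?f] Suc.prems(1) obtain w f' where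
    "w \<in> lists (\<Sigma> \<times> D)" "loaded f' x" "run A (x + i, ?f) w (1, f')" by auto
  with step a d show ?case
    by (intro bexI[of _ "(a, d) # w"] exI[of _ f']) (auto intro: run_Cons)
qed

section \<open>From accepting runs to halting computations\<close>

text \<open>Injectivity of \<open>h\<close> recovers the control point from the state, and the
  guards admit only the branch that fits the counter. Halting is transferred backwards, as the
  induction along an accepting run needs.\<close>

lemma step_control:
  assumes "step A (h ks, f) (b, d) (q', f')" "ks \<in> points prog []" "repr D k f s" "d \<in> D"
  shows "\<exists>js s'. js \<in> points prog [] \<and> q' = h js \<and> repr D k f' s' \<and> (halts js s' \<longrightarrow> halts ks s)"
proof -
  from assms(1) obtain t where t: "t \<in> Trans A" "src t = h ks" "enabled {..<x} t f d"
    "q' = tgt t" "f' = update {..<x} t f d"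
    by (auto simp: step_def Regs_A)
  have "src t = h js" if "t \<in> instr {..<x} a k h js" for js
    using that by (cases js rule: succs.cases) (auto simp: mk_transition_def)
  moreover have "h ks < B" using assms(2) h_less by simp
  \<comment> \<open>The transitions \<open>idle\<close>, \<open>jump\<close> and \<open>load\<close>
    start at \<open>B\<close> or above, so only the instruction at \<open>ks\<close>
    remains.\<close>
  ultimately have instr: "t \<in> instr {..<x} a k h ks"
    using t(1,2) x inj_onD[OF inj_h _ assms(2)]
    by (auto simp: Trans_A control_def idle_def load_def jump_def mk_transition_def)
  show ?thesis
  proof (cases ks)
    case Nil
    with instr show ?thesis by simp
  next
    case (Cons c cs)
    have r: "reg c < k" using assms(2) Cons reg_less by blast
    have closed: "succs ks \<subseteq> points prog []" using assms(2) by (rule points_closed)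
    show ?thesis
    proof (cases c)
      case (Inc r)
      with Cons instr have t_eq: "t = mk_transition {..<x} (h (Inc r # cs)) a {} {2 * r} (\<lambda>_. {})
        ((keep (2 * k))(2 * r := {Reg (2 * r), In})) (h cs)"
        by simp
      then have "d \<notin> f (2 * r)" using t(3) by (simp add: enabled_def mk_transition_def)
      then have "repr D k f' (s(r := Suc (s r)))"
        using r Inc assms(4) update_keep
        by (intro repr_inc[OF assms(3)]) (auto simp: t(5) t_eq)
      moreover have "q' = h cs" by (simp add: t(4) t_eq mk_transition_def)
      ultimately show ?thesis using closed Cons Inc by (auto simp: halts_Inc_iff)
    next
      case (Loop r b)
      with Cons instr consider
        (pos) "t = mk_transition {..<x} (h (Loop r b # cs)) a {2 * r} {2 * r + 1} (\<lambda>_. {})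
          ((keep (2 * k))(2 * r + 1 := {Reg (2 * r + 1), In})) (h (b @ Loop r b # cs))" |
        (zero) "t = mk_transition {..<x} (h (Loop r b # cs)) a {} {} ((\<lambda>_. {})(2 * r := {2 * r + 1}))
          (keep (2 * k)) (h cs)"
        by auto
      then show ?thesis
      proof cases
        case pos
        then have "d \<in> f (2 * r)" "d \<notin> f (2 * r + 1)"
          using t(3) by (simp_all add: enabled_def mk_transition_def)
        then have "\<exists>n. s r = Suc n \<and> repr D k f' (s(r := n))"
          using r Loop assms(4) update_keep
          by (intro repr_dec[OF assms(3)]) (auto simp: t(5) pos)
        moreover have "q' = h (b @ Loop r b # cs)" by (simp add: t(4) pos mk_transition_def)
        ultimately show ?thesis
          using closed Cons Loop
          by (intro exI[of _ "b @ Loop r b # cs"]) (auto simp: halts_Loop_Suc_iff)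
      next
        case zero
        have "f (2 * r + 1) = f (2 * r)"
          using t(3) zero r Loop k_less x by (auto simp: enabled_def mk_transition_def)
        then have "s r = 0" using repr_zero[OF assms(3)] r Loop by simp
        moreover have "repr D k f' s"
          using assms(4) update_keep by (intro repr_cong[OF assms(3)]) (auto simp: t(5) zero)
        moreover have "q' = h cs" by (simp add: t(4) zero mk_transition_def)
        ultimately show ?thesis using closed Cons Loop by (auto simp: halts_Loop_0_iff)
      qed
    qed
  qed
qed

lemma run_halts:
  assumes "run A cf w cf'" "w \<in> lists (\<Sigma> \<times> D)" "ks \<in> points prog []" "fst cf = h ks" "repr D k (snd cf) s"
    "fst cf' = 0"
  shows "halts ks s"
  using assms
proof (induction arbitrary: ks s)
  case (run_Nil cf)
  then have "h ks = h []" using h_Nil by simp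
  \<comment> \<open>Among the control points only the empty program has number 0.\<close>
  then have "ks = []" using inj_onD[OF inj_h] run_Nil exit_in_points by blast
  then show ?case by (simp add: halts.halts_Nil)
next
  case (run_Cons cf x cf1 w cf2)
  then show ?case
    using step_control[of ks "snd cf" "fst x" "snd x" "fst cf1" "snd cf1" s] by (cases cf) fastforce
qed

lemma run_load_halts:
  assumes "run A cf w cf'" "w \<in> lists (\<Sigma> \<times> D)" "fst cf = x + i" "i \<le> x" "loaded (snd cf) (x - i)"
    "fst cf' = 0"
  shows "halts prog ((\<lambda>_. 0)(0 := x))"
  using assms
proof (induction arbitrary: i)
  case (run_Nil cf)
  \<comment> \<open>Loading states are positive, so the empty run does not end in 0.\<close>
  then show ?case using x by simp
next
  case (run_Cons cf y cf1 w cf2)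
  have "step A (fst cf, snd cf) (fst y, snd y) (fst cf1, snd cf1)" "snd y \<in> D"
    using run_Cons.hyps(1) run_Cons.prems(1) by auto
  from step_load[OF this(1) run_Cons.prems(2-4) this(2)]
  consider "fst cf1 = 1" "loaded (snd cf1) x"
    | j where "i = Suc j" "fst cf1 = x + j" "loaded (snd cf1) (x - j)" by auto
  then show ?case
  proof cases
    case 1
    have "prog \<in> points prog []" using append_in_points[of prog "[]"] by simp
    with 1 run_Cons.hyps(2) run_Cons.prems(1,5) h_prog show ?thesis
      by (intro run_halts[of cf1 w cf2 prog] loaded_repr) simp_all
  next
    case 2
    with run_Cons show ?thesis by auto
  qed
qed

text \<open>The initial state \<open>2 * x\<close> is \<open>x + i\<close> for \<open>i = x\<close>,
  with nothing loaded. Both directions pass through state 1, reached after loading with counter 0 at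
  \<open>x\<close>.\<close>

lemma language_empty_iff:
  "rsa_language \<Sigma> D A = {} \<longleftrightarrow> \<not> halts prog ((\<lambda>_. 0)(0 := x))"
proof -
  let ?f = "\<lambda>r\<in>{..<x}. {} :: 'd set"
  have init: "initial_config A cf \<longleftrightarrow> cf = (x + x, ?f)" for cf :: "(nat, nat, 'd) config"
    by (cases cf) (auto simp: initial_config_def automaton_def mult_2)
  have final: "Final A = {0}" by (simp add: automaton_def)
  have f: "loaded ?f (x - x)" using x by (simp add: loaded_def)
  have "rsa_language \<Sigma> D A \<noteq> {}" if halts: "halts prog ((\<lambda>_. 0)(0 := x))"
  proof -
    from run_load[OF order_refl f] obtain v f' where
      v: "v \<in> lists (\<Sigma> \<times> D)" "loaded f' x" "run A (x + x, ?f) v (1, f')" by blast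
    have "prog \<in> points prog []" using append_in_points[of prog "[]"] by simp
    from halts_run[OF halts this loaded_repr[OF v(2)]] obtain w f'' where
      "w \<in> lists (\<Sigma> \<times> D)" "run A (1, f') w (0, f'')" by (auto simp: h_prog)
    with v have "v @ w \<in> rsa_language \<Sigma> D A"
      by (auto simp: rsa_language_def init final intro: run_append)
    then show ?thesis by blast
  qed
  moreover have "halts prog ((\<lambda>_. 0)(0 := x))" if "w \<in> rsa_language \<Sigma> D A" for w
  proof -
    from that obtain cf' where "w \<in> lists (\<Sigma> \<times> D)" "run A (x + x, ?f) w cf'" "fst cf' = 0"
      by (auto simp: rsa_language_def init final)
    with run_load_halts[of "(x + x, ?f)" w cf' x] f show ?thesis by simp
  qed
  ultimately show ?thesis by blast
qed

end

end

section \<open>Computing the code of the automaton\<close>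

definition computable :: "nat \<Rightarrow> (nat list \<Rightarrow> nat) \<Rightarrow> bool" where
  "computable n f \<longleftrightarrow> (\<exists>p. \<forall>xs. length xs = n \<longrightarrow> eval p xs (f xs))"

lemma computable_nth: "i < n \<Longrightarrow> computable n (\<lambda>xs. xs ! i)"
  unfolding computable_def by (auto intro!: exI[of _ "Proj i"] eval_Proj)

lemma computable_comp:
  assumes "computable (length gs) f" "\<And>g. g \<in> set gs \<Longrightarrow> computable n g"
  shows "computable n (\<lambda>xs. f (map (\<lambda>g. g xs) gs))"
proof -
  obtain p where p: "\<And>xs. length xs = length gs \<Longrightarrow> eval p xs (f xs)"
    using assms(1) by (auto simp: computable_def)
  from assms(2) obtain q where q: "\<And>g xs. g \<in> set gs \<Longrightarrow> length xs = n \<Longrightarrow> eval (q g) xs (g xs)"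
    unfolding computable_def by metis
  have "eval (Comp p (map q gs)) xs (f (map (\<lambda>g. g xs) gs))" if "length xs = n" for xs
    by (rule eval_Comp[OF _ p]) (use that q in \<open>auto simp: list_all2_conv_all_nth\<close>)
  then show ?thesis unfolding computable_def by blast
qed

lemma computable_comp1:
  assumes "computable 1 (\<lambda>xs. f (xs ! 0))" "computable n g"
  shows "computable n (\<lambda>xs. f (g xs))"
  using computable_comp[of "[g]" "\<lambda>xs. f (xs ! 0)" n] assms by simp

lemma computable_comp2:
  assumes "computable 2 (\<lambda>xs. f (xs ! 0) (xs ! 1))" "computable n g" "computable n h"
  shows "computable n (\<lambda>xs. f (g xs) (h xs))"
  using computable_comp[of "[g, h]" "\<lambda>xs. f (xs ! 0) (xs ! 1)" n] assms
  by (auto simp: numeral_2_eq_2)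

lemma computable_Suc: "computable n f \<Longrightarrow> computable n (\<lambda>xs. Suc (f xs))"
proof (rule computable_comp1[where f = Suc])
  have "eval Succ xs (Suc (xs ! 0))" if "length xs = 1" for xs
    using that by (cases xs) (auto intro: eval_Succ)
  then show "computable 1 (\<lambda>xs. Suc (xs ! 0))" unfolding computable_def by blast
qed

lemma computable_const: "computable n (\<lambda>_. k)"
proof (induction k)
  case 0
  show ?case unfolding computable_def by (blast intro: eval_Zero)
qed (rule computable_Suc)

lemma computable_prim_rec:
  assumes "computable n f" "computable (Suc (Suc n)) g"
    and h_0: "\<And>xs. length xs = n \<Longrightarrow> h (0 # xs) = f xs"
    and h_Suc: "\<And>i xs. length xs = n \<Longrightarrow> h (Suc i # xs) = g (i # h (i # xs) # xs)"
  shows "computable (Suc n) h"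
proof -
  obtain p q where p: "\<And>xs. length xs = n \<Longrightarrow> eval p xs (f xs)"
    and q: "\<And>xs. length xs = Suc (Suc n) \<Longrightarrow> eval q xs (g xs)"
    using assms(1,2) by (auto simp: computable_def)
  have "eval (PrimRec p q) (i # xs) (h (i # xs))" if "length xs = n" for i xs
  proof (induction i)
    case 0
    show ?case unfolding h_0[OF that] by (rule eval_PrimRec_0, rule p[OF that])
  next
    case (Suc i)
    show ?case unfolding h_Suc[OF that]
      by (rule eval_PrimRec_Suc[OF Suc], rule q) (simp add: that)
  qed
  then have "eval (PrimRec p q) xs (h xs)" if "length xs = Suc n" for xs
    using that by (cases xs) auto
  then show ?thesis unfolding computable_def by blast
qed

lemma computable_add:
  assumes "computable n f" "computable n g"
  shows "computable n (\<lambda>xs. f xs + g xs)"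
proof (rule computable_comp2[OF _ assms])
  have "computable (Suc 1) (\<lambda>xs. xs ! 0 + xs ! 1)"
    by (rule computable_prim_rec[where f = "\<lambda>xs. xs ! 0" and g = "\<lambda>xs. Suc (xs ! 1)"])
      (auto intro: computable_nth computable_Suc)
  then show "computable 2 (\<lambda>xs. xs ! 0 + xs ! 1)" by (simp add: numeral_2_eq_2)
qed

lemma computable_sum:
  assumes "computable (Suc n) g"
  shows "computable (Suc n) (\<lambda>xs. \<Sum>i<hd xs. g (i # tl xs))"
proof -
  \<comment> \<open>A recursion step receives the index, the partial sum and the parameters;
    \<open>?args\<close> drops the partial sum.\<close>
  let ?args = "(\<lambda>xs. xs ! 0) # map (\<lambda>i xs. xs ! Suc (Suc i)) [0..<n]"
  have "computable (Suc (Suc n)) (\<lambda>xs. g (map (\<lambda>f. f xs) ?args))"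
    by (rule computable_comp) (use assms in \<open>auto intro: computable_nth\<close>)
  then have step: "computable (Suc (Suc n)) (\<lambda>xs. xs ! 1 + g (map (\<lambda>f. f xs) ?args))"
    by (intro computable_add computable_nth) auto
  have args: "map (\<lambda>f. f (i # y # xs)) ?args = i # xs" if "length xs = n" for i y and xs :: "nat list"
    using that by (auto simp: comp_def map_nth)
  show ?thesis
    by (rule computable_prim_rec[OF computable_const step]) (simp_all only: args, simp_all)
qed

lemma computable_power2:
  assumes "computable n f"
  shows "computable n (\<lambda>xs. 2 ^ f xs)"
proof (rule computable_comp1[OF _ assms])
  have "computable (Suc 0) (\<lambda>xs. 2 ^ (xs ! 0))"
    by (rule computable_prim_rec[where f = "\<lambda>_. 1" and g = "\<lambda>xs. xs ! 1 + xs ! 1"])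
      (auto intro: computable_nth computable_add computable_const)
  then show "computable 1 (\<lambda>xs. 2 ^ (xs ! 0))" by simp
qed

lemma computable_prod_encode:
  assumes "computable n f" "computable n g"
  shows "computable n (\<lambda>xs. prod_encode (f xs, g xs))"
proof -
  \<comment> \<open>\<open>prod_encode (m, n)\<close> is \<open>triangle (m + n) + m\<close>, and
    \<open>triangle (Suc n)\<close> is \<open>triangle n + Suc n\<close>.\<close>
  have "computable (Suc 0) (\<lambda>xs. triangle (xs ! 0))"
    by (rule computable_prim_rec[where f = "\<lambda>_. 0" and g = "\<lambda>xs. xs ! 1 + Suc (xs ! 0)"];
        (intro computable_add computable_Suc computable_nth computable_const)?) simp_all
  then have "computable n (\<lambda>xs. triangle (f xs + g xs))"
    using computable_comp1[of triangle] computable_add[OF assms] by simp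
  with assms show ?thesis by (simp add: prod_encode_def computable_add)
qed

section \<open>Codes of transitions over varying register sets\<close>

text \<open>Only pairs with an actual element enter the code, so registers mapped to the empty set
  leave no trace in it.\<close>

lemma fun_code_restrict:
  assumes "S \<subseteq> R" "\<And>r. r \<in> R - S \<Longrightarrow> g r = {}"
  shows "fun_code R k (restrict g R) = fun_code S k (restrict g S)"
  unfolding fun_code_def using assms by (intro arg_cong[where f = set_encode]) fastforce

lemma transition_code_mk_transition:
  assumes "S \<subseteq> R" "\<And>r. r \<in> R - S \<Longrightarrow> E r = {} \<and> u r = {}"
  shows "transition_code c R (mk_transition R q a G N E u q') =
    list_encode [q, c a, set_encode G, set_encode N, fun_code S id (restrict E S),
      fun_code S source_code (restrict u S), q']"
  using fun_code_restrict[of S R E id] fun_code_restrict[of S R u source_code] assms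
  by (simp add: transition_code_def mk_transition_def)

text \<open>The code of a loading transition with the register set cut down to register 0: only the
  two state numbers still vary. Here \<open>l\<close> is the number of the letter, and the entry 0
  codes the empty set.\<close>

definition load_code :: "nat \<Rightarrow> nat \<Rightarrow> nat \<Rightarrow> nat" where
  "load_code l x i = list_encode [Suc (x + i), l, 0, set_encode {0}, fun_code {0} id (\<lambda>r\<in>{0}. {}),
     fun_code {0} source_code (restrict ((\<lambda>_. {})(0 := {Reg 0, In})) {0}), x + i]"

definition jump_code :: "nat \<Rightarrow> nat \<Rightarrow> nat" where
  "jump_code l x = list_encode [x, l, 0, 0, fun_code {0} id (\<lambda>r\<in>{0}. {}),
     fun_code {0} source_code (restrict ((\<lambda>_. {})(0 := {Reg 0})) {0}), 1]"

lemma transition_code_load: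
  assumes "x > 0"
  shows "transition_code c {..<x} (load a x i) = load_code (c a) x i"
  unfolding load_def load_code_def using assms
  by (subst transition_code_mk_transition[of "{0}"]) auto

lemma transition_code_jump:
  assumes "x > 0"
  shows "transition_code c {..<x} (jump a x) = jump_code (c a) x"
  unfolding jump_def jump_code_def using assms
  by (subst transition_code_mk_transition[of "{0}"]) auto

text \<open>The code of the automaton that loads \<open>x\<close> if the transitions of its control part have the
  code \<open>x\<close> as well.\<close>

definition self_code :: "nat \<Rightarrow> nat \<Rightarrow> nat" where
  "self_code l x = list_encode
     [\<Sum>i<Suc (x + x). 2 ^ i, \<Sum>i<x. 2 ^ i, x + (2 ^ jump_code l x + (\<Sum>i<x. 2 ^ load_code l x i)),
      2 ^ (x + x), 1]"

lemma computable_self_code: "computable 1 (\<lambda>xs. self_code l (xs ! 0))"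
proof -
  have bits: "computable 1 (\<lambda>xs. \<Sum>i<f xs. 2 ^ i)" if "computable 1 f" for f
  proof (rule computable_comp1[OF _ that])
    have "computable (Suc 0) (\<lambda>xs. \<Sum>i<hd xs. 2 ^ ((i # tl xs) ! 0))"
      by (rule computable_sum) (intro computable_power2 computable_nth, simp)
    moreover have "hd xs = xs ! 0" if "length xs = Suc 0" for xs :: "nat list"
      using that by (cases xs) auto
    ultimately show "computable 1 (\<lambda>xs. \<Sum>i<xs ! 0. 2 ^ i)"
      by (simp add: computable_def)
  qed
  have x: "computable 1 (\<lambda>xs. xs ! 0)" by (rule computable_nth) simp
  have "computable 2 (\<lambda>xs. load_code l (xs ! 1) (xs ! 0))"
    unfolding load_code_def list_encode.simps
    by (intro computable_Suc computable_prod_encode computable_add computable_const computable_nth)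
      simp_all
  then have "computable (Suc 1) (\<lambda>xs. 2 ^ load_code l (xs ! 1) (xs ! 0))"
    using computable_power2 by (simp add: numeral_2_eq_2)
  then have "computable 2 (\<lambda>xs. \<Sum>i<hd xs. 2 ^ load_code l ((i # tl xs) ! 1) ((i # tl xs) ! 0))"
    using computable_sum[of 1 "\<lambda>xs. 2 ^ load_code l (xs ! 1) (xs ! 0)"] by (simp add: numeral_2_eq_2)
  \<comment> \<open>Both the bound of the sum and its parameter are \<open>x\<close>.\<close>
  from computable_comp[of "[\<lambda>xs. xs ! 0, \<lambda>xs. xs ! 0]", OF _ , of _ 1] this x
  have loads: "computable 1 (\<lambda>xs. \<Sum>i<xs ! 0. 2 ^ load_code l (xs ! 0) i)"
    by (fastforce simp: numeral_2_eq_2)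
  have jump: "computable 1 (\<lambda>xs. jump_code l (xs ! 0))"
    unfolding jump_code_def list_encode.simps
    by (intro computable_Suc computable_prod_encode computable_const x)
  show ?thesis
    unfolding self_code_def list_encode.simps
    by (intro computable_Suc computable_prod_encode computable_const bits computable_add loads
        computable_power2 jump x)
qed

lemma less_list_encode: "x < list_encode (x # xs)"
  using le_prod_encode_1[of x "list_encode xs"] by (simp add: le_imp_less_Suc)

lemma less_set_encode:
  assumes "finite X" "x \<in> X"
  shows "x < set_encode X"
proof -
  have "x < 2 ^ x" by (rule less_exp)
  also have "\<dots> \<le> set_encode X"
    unfolding set_encode_def using assms by (intro member_le_sum) auto
  finally show ?thesis .
qed

section \<open>An automaton that loads the code of its own control part\<close>

context counter_automaton
begin

text \<open>Taken over the \<open>2 * k\<close> registers of the counters, so it does not refer to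
  \<open>x\<close>. This makes the choice \<open>x = control_code c\<close> free of
  circularity.\<close>

definition control_code :: "('a \<Rightarrow> nat) \<Rightarrow> nat" where
  "control_code c = set_encode (transition_code c {..<2 * k} ` control {..<2 * k})"

lemma finite_control: "finite (control R)"
proof -
  have "finite (instr R a k h ks)" for ks
    by (cases ks rule: succs.cases) auto
  then show ?thesis by (simp add: control_def finite_points)
qed

lemma src_control:
  assumes "t \<in> control R"
  shows "src t \<le> B"
proof -
  have "src t = h ks" if "t \<in> instr R a k h ks" for ks
    using that by (cases ks rule: succs.cases) (auto simp: mk_transition_def)
  then show ?thesis
    using assms h_less by (fastforce simp: control_def idle_def mk_transition_def)
qed

text \<open>The source of \<open>idle\<close> is \<open>B\<close>; the code of a list exceeds its
  head, and that of a finite set exceeds its elements.\<close>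

lemma less_control_code: "B < control_code c"
proof -
  let ?t = "idle {..<2 * k} a B"
  have "B < transition_code c {..<2 * k} ?t"
    using less_list_encode[of B] by (simp add: transition_code_def idle_def mk_transition_def del: list_encode.simps)
  also have "\<dots> < control_code c"
    unfolding control_code_def
    by (intro less_set_encode finite_imageI finite_control imageI) (simp add: control_def)
  finally show ?thesis .
qed

text \<open>Control transitions neither test nor keep registers from \<open>2 * k\<close> on, so
  both sides reduce to the same code over \<open>{..<2 * k}\<close>.\<close>

lemma transition_code_control:
  assumes "2 * k \<le> x"
  shows "transition_code c {..<x} ` control {..<x} = transition_code c {..<2 * k} ` control {..<2 * k}"
proof -
  have eq: "transition_code c {..<x} (mk_transition {..<x} q a G N E u q') =
      transition_code c {..<2 * k} (mk_transition {..<2 * k} q a G N E u q')"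
    if "\<And>r. 2 * k \<le> r \<Longrightarrow> E r = {} \<and> u r = {}" for q G N E u q'
    by (rule trans[OF transition_code_mk_transition[where S = "{..<2 * k}"]
          transition_code_mk_transition[where S = "{..<2 * k}", symmetric]])
      (use assms that in auto)
  have "transition_code c {..<x} ` instr {..<x} a k h ks =
    transition_code c {..<2 * k} ` instr {..<2 * k} a k h ks" if "ks \<in> points prog []" for ks
  proof (cases ks rule: succs.cases)
    case (2 r js)
    then have "r < k" using that reg_less by fastforce
    with 2 show ?thesis
      by (simp only: instr.simps image_insert image_empty, subst eq) (auto simp: keep_def)
  next
    case (3 r b js)
    then have "r < k" using that reg_less by fastforce
    with 3 show ?thesis
      by (simp only: instr.simps image_insert image_empty, subst (1 2) eq) (auto simp: keep_def)
  qed simp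
  then show ?thesis
    by (simp add: control_def image_UN idle_def eq)
qed

text \<open>By the choice of \<open>x\<close> the control transitions contribute exactly
  \<open>x\<close> to the code. The other transitions have larger sources, so their codes differ
  from those and the bits add up.\<close>

lemma rsa_code_automaton:
  assumes x: "x = control_code c"
  shows "rsa_code c (automaton x) = self_code (c a) x"
proof -
  let ?tc = "transition_code c {..<x}"
  let ?loads = "load_code (c a) x ` {..<x}"
  have "B < x" using less_control_code x by simp
  then have pos: "x > 0" and kx: "2 * k \<le> x" using k_less by simp_all
  have src: "src t = src t'" if "?tc t = ?tc t'" for t t'
    using that by (simp add: transition_code_def list_encode_eq del: list_encode.simps)
  have disj: "?tc ` control {..<x} \<inter> ?tc ` insert (jump a x) (load a x ` {..<x}) = {}"
  proof -
    have src_ge: "x \<le> src t" if "t \<in> insert (jump a x) (load a x ` {..<x})" for t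
      using that by (auto simp: jump_def load_def mk_transition_def)
    have "?tc t \<noteq> ?tc t'" if "t \<in> control {..<x}" "t' \<in> insert (jump a x) (load a x ` {..<x})" for t t'
      using src[of t t'] src_control[OF that(1)] src_ge[OF that(2)] \<open>B < x\<close> by linarith
    then show ?thesis by blast
  qed
  have codes: "?tc ` insert (jump a x) (load a x ` {..<x}) = insert (jump_code (c a) x) ?loads"
    using pos by (auto simp: transition_code_load transition_code_jump image_image)
  have "jump_code (c a) x \<notin> ?loads"
    by (auto simp: jump_code_def load_code_def list_encode_eq simp del: list_encode.simps)
  moreover have "inj_on (load_code (c a) x) {..<x}"
    by (auto simp: inj_on_def load_code_def list_encode_eq simp del: list_encode.simps)
  ultimately have "set_encode (insert (jump_code (c a) x) ?loads) =
    2 ^ jump_code (c a) x + (\<Sum>i<x. 2 ^ load_code (c a) x i)"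
    by (simp add: set_encode_def sum.reindex)
  moreover have "set_encode (?tc ` Trans (automaton x)) =
    set_encode (?tc ` control {..<x}) + set_encode (insert (jump_code (c a) x) ?loads)"
    unfolding set_encode_def codes[symmetric]
    using disj by (subst sum.union_disjoint[symmetric]) (auto simp: finite_control automaton_def image_Un)
  ultimately have "set_encode (?tc ` Trans (automaton x)) =
    x + (2 ^ jump_code (c a) x + (\<Sum>i<x. 2 ^ load_code (c a) x i))"
    by (simp add: transition_code_control[OF kx] control_code_def[symmetric] x[symmetric])
  then show ?thesis
    by (simp add: rsa_code_def self_code_def automaton_def set_encode_def lessThan_Suc_atMost mult_2
        del: list_encode.simps sum.lessThan_Suc)
qed

end

section \<open>The diagonal argument\<close>

lemma counter_automaton_exists:
  assumes "infinite D" "a \<in> \<Sigma>" "prog \<noteq> []"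
  obtains h k B where "counter_automaton D \<Sigma> a prog h k B"
proof -
  let ?W = "points prog []"
  obtain f :: "com list \<Rightarrow> nat" where f: "inj_on f ?W"
    using finite_imp_inj_to_nat_seg[OF finite_points] by metis
  \<comment> \<open>The numbers 0 and 1 are reserved for the end and the start, which differ since
    \<open>prog\<close> is nonempty.\<close>
  define h where "h ks = (if ks = [] then 0 else if ks = prog then 1 else Suc (Suc (f ks)))" for ks
  have inj: "inj_on h ?W"
    using f by (auto simp: inj_on_def h_def)
  \<comment> \<open>The point \<open>[]\<close> contributes the unspecified \<open>hd []\<close>.
    This only affects the size of \<open>k\<close>, and the strict bound gives
    \<open>0 < k\<close>.\<close>
  obtain k where k: "\<And>ks. ks \<in> ?W \<Longrightarrow> reg (hd ks) < k"
    using finite_points[of prog "[]"] finite_nat_set_iff_bounded[of "(\<lambda>ks. reg (hd ks)) ` ?W"] by auto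
  obtain B where B: "\<And>ks. ks \<in> ?W \<Longrightarrow> h ks < B"
    using finite_points[of prog "[]"] finite_nat_set_iff_bounded[of "h ` ?W"] by auto
  have "counter_automaton D \<Sigma> a prog h k (B + 2 * k + 1)"
  proof
    show "reg c < k" if "c # ks \<in> ?W" for c ks
      using k[OF that] by simp
    show "0 < k" using k[OF exit_in_points] by simp
      show "h ks < B + 2 * k + 1" if "ks \<in> ?W" for ks
      using B[OF that] by simp
  qed (use assms inj in \<open>auto simp: h_def\<close>)
  then show thesis by (rule that)
qed

theorem theorem7p2:
  fixes \<Sigma> :: "'a set" and \<DD> :: "'d set" and c :: "'a \<Rightarrow> nat"
  assumes "finite \<Sigma>" and "\<Sigma> \<noteq> {}" and "infinite \<DD>" and "inj_on c \<Sigma>"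
  shows "\<not> decidable (rsa_code c) {A. is_rsa \<Sigma> A} (\<lambda>A. rsa_language \<Sigma> \<DD> A = {})"
proof
  assume "decidable (rsa_code c) {A. is_rsa \<Sigma> A} (\<lambda>A. rsa_language \<Sigma> \<DD> A = {})"
  then obtain p where p: "\<And>A. is_rsa \<Sigma> A \<Longrightarrow>
      eval p [rsa_code c A] (if rsa_language \<Sigma> \<DD> A = {} then 1 else 0)"
    unfolding decidable_def by blast
  from assms(2) obtain a where a: "a \<in> \<Sigma>" by blast
  obtain q where "\<And>xs. length xs = 1 \<Longrightarrow> eval q xs (self_code (c a) (xs ! 0))"
    using computable_self_code[of "c a"] unfolding computable_def by blast
  from this[of "[x]" for x] have q: "eval q [x] (self_code (c a) x)" for x by simp
  \<comment> \<open>The primitive recursion sends 0 to 1 and each successor to 0, so it negates the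
    verdict of \<open>p\<close>. Register 0 holds the input and register 1 the negated verdict; the
    final loop terminates only if the verdict was 1, that is, "empty".\<close>
  define prog where "prog = compile (Comp (PrimRec (Comp Succ [Zero]) Zero) [Comp p [q]]) [0] 1 2 @
    [Loop 1 [Inc 1]]"
  obtain h k B where "counter_automaton \<DD> \<Sigma> a prog h k B"
    by (rule counter_automaton_exists[OF assms(3) a, of prog]) (auto simp: prog_def)
  then interpret counter_automaton \<DD> \<Sigma> a prog h k B .
  \<comment> \<open>The fixed point: for this \<open>x\<close> the computed
    \<open>self_code (c a) x\<close> is the code of \<open>automaton x\<close> itself.\<close>
  define x where "x = control_code c"
  have x: "B < x" using less_control_code by (simp add: x_def)
  define v :: nat where "v = (if rsa_language \<Sigma> \<DD> (automaton x) = {} then 1 else 0)"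
  let ?s = "(\<lambda>_. 0)(0 := x)"
  have "eval p [self_code (c a) x] v"
    using p[OF is_rsa_automaton[OF x]] unfolding v_def rsa_code_automaton[OF x_def] .
  then have "eval (Comp p [q]) [x] v"
    using q by (intro eval_Comp[where ys = "[self_code (c a) x]"]) auto
  moreover have "eval (PrimRec (Comp Succ [Zero]) Zero) [v] (1 - v)"
  proof -
    have 1: "eval (PrimRec (Comp Succ [Zero]) Zero) [0] 1"
      using eval_Comp[of "[]" "[Zero]" "[0]" Succ 1] by (auto intro: eval_PrimRec_0 eval_Zero eval_Succ[of 0, simplified])
    then have "eval (PrimRec (Comp Succ [Zero]) Zero) [Suc 0] 0"
      by (rule eval_PrimRec_Suc) (rule eval_Zero)
    with 1 show ?thesis by (simp add: v_def)
  qed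
  ultimately have "eval (Comp (PrimRec (Comp Succ [Zero]) Zero) [Comp p [q]]) [x] (1 - v)"
    by (intro eval_Comp[where ys = "[v]"]) auto
  then have "leads (compile (Comp (PrimRec (Comp Succ [Zero]) Zero) [Comp p [q]]) [0] 1 2) ?s (?s(1 := 1 - v))"
    by (intro correctD[OF compile_correct]) auto
  then have "halts prog ?s \<longleftrightarrow> halts [Loop 1 [Inc 1]] (?s(1 := 1 - v))"
    by (simp add: leads_def prog_def)
  also have "\<dots> \<longleftrightarrow> v = 1"
    using not_halts_Loop_Inc[of "?s(1 := 1 - v)" 1] halts_Loop_0_iff[of "?s(1 := 1 - v)" 1]
    by (auto simp: v_def halts_Nil)
  \<comment> \<open>The program halts iff the verdict is "empty", and the language is empty iff the
    program does not halt.\<close>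
  also have "\<dots> \<longleftrightarrow> \<not> halts prog ?s"
    using language_empty_iff[OF x] by (simp add: v_def)
  finally show False by blast
qed

end
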